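(* Let $\gamma:(s_1,s_2)\to\mathbb{R}^2$ be a loop, i.e. a simple smooth curve with non-vanishing curvature such that $\lim_{s\to s_1^+}\gamma(s)=\lim_{s\to s_2^-}\gamma(s)$, and let $L=\gamma((s_1,s_2))$ be its image. Then the Wigner caustic $E_{\frac12}(L)$ of $L$ has a singular point.
   Context: All smooth curves are $C^\infty$; "simple" means without self-intersections. A pair of different points $a,b$ of a curve $M\subset\mathbb{R}^2$ is a parallel pair if the tangent lines $T_aM$ and $T_bM$ are parallel. For $\lambda\in\mathbb{R}$ the affine $\lambda$-equidistant of $M$ is $E_\lambda(M)=\{\lambda a+(1-\lambda)b : a,b \text{ is a parallel pair of } M\}$, and the Wigner caustic of $M$ is $E_{\frac12}(M)$. Singular points: let a curve be parameterized by $f$. The point $f(s_0)$ is a $C^k$ regular point ($k=1,2,\ldots$ or $\infty$) if there exists $\varepsilon>0$ such that $f((s_0-\varepsilon,s_0+\varepsilon))$ is a $C^k$ smooth $1$-dimensional manifold. A point $f(s_0)$ which is not $C^k$ regular for any $k>0$ is called a singular point. For equidistants of a curve with non-vanishing curvature, the relevant local parameterizations (branches) are $s\mapsto \lambda\gamma(s)+(1-\lambda)\gamma(t(s))$, where $t$ is a smooth function such that $\gamma(s),\gamma(t(s))$ is a parallel pair for every $s$. *)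

theory Defs
  imports "HOL-Analysis.Analysis" "HOL-Library.Extended_Nat"
begin

section \<open>Curves of class \<open>C\<^sup>k\<close>\<close>

text \<open>Intended for open \<open>S\<close>, where the two-sided derivative at a point of \<open>S\<close> only
  depends on the values of the function on \<open>S\<close>.\<close>

primrec Cn_on :: "nat \<Rightarrow> (real \<Rightarrow> 'a::real_normed_vector) \<Rightarrow> real set \<Rightarrow> bool" where
  "Cn_on 0 f S \<longleftrightarrow> continuous_on S f"
| "Cn_on (Suc n) f S \<longleftrightarrow>
     (\<exists>f'. (\<forall>x\<in>S. (f has_vector_derivative f' x) (at x)) \<and> Cn_on n f' S)"

definition Ck_on :: "enat \<Rightarrow> (real \<Rightarrow> 'a::real_normed_vector) \<Rightarrow> real set \<Rightarrow> bool" where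
  "Ck_on k f S \<longleftrightarrow> (\<forall>n. enat n \<le> k \<longrightarrow> Cn_on n f S)"

abbreviation smooth_on :: "(real \<Rightarrow> 'a::real_normed_vector) \<Rightarrow> real set \<Rightarrow> bool" where
  "smooth_on \<equiv> Ck_on \<infinity>"

abbreviation velocity :: "(real \<Rightarrow> real^2) \<Rightarrow> real \<Rightarrow> real^2" where
  "velocity \<gamma> s \<equiv> vector_derivative \<gamma> (at s)"

definition curvature :: "(real \<Rightarrow> real^2) \<Rightarrow> real \<Rightarrow> real" where
  "curvature \<gamma> s =
     (velocity \<gamma> s $ 1 * velocity (velocity \<gamma>) s $ 2 - velocity \<gamma> s $ 2 * velocity (velocity \<gamma>) s $ 1)
       / norm (velocity \<gamma> s) ^ 3"

text \<open>Simplicity is injectivity on the open interval; nothing is required about whether the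
  common limit at the two ends lies on the curve.\<close>

definition is_loop :: "(real \<Rightarrow> real^2) \<Rightarrow> real \<Rightarrow> real \<Rightarrow> bool" where
  "is_loop \<gamma> s1 s2 \<longleftrightarrow>
     s1 < s2 \<and>
     smooth_on \<gamma> {s1<..<s2} \<and>
     (\<forall>s\<in>{s1<..<s2}. velocity \<gamma> s \<noteq> 0) \<and>
     inj_on \<gamma> {s1<..<s2} \<and>
     (\<forall>s\<in>{s1<..<s2}. curvature \<gamma> s \<noteq> 0) \<and>
     (\<exists>p. (\<gamma> \<longlongrightarrow> p) (at_right s1) \<and> (\<gamma> \<longlongrightarrow> p) (at_left s2))"

section \<open>Parallel pairs and equidistants\<close>

text \<open>Below, \<open>S\<close> is the parameter domain of \<open>\<gamma>\<close> and the curve is \<open>M = \<gamma> ` S\<close>.\<close>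

definition tangent_line :: "(real \<Rightarrow> real^2) \<Rightarrow> real \<Rightarrow> (real^2) set" where
  "tangent_line \<gamma> s = {\<gamma> s + c *\<^sub>R velocity \<gamma> s | c. True}"

text \<open>\<^const>\<open>affine_parallel\<close> relates translates of each other, so equal tangent lines at
  different points count as parallel.\<close>

definition parallel_pair :: "(real \<Rightarrow> real^2) \<Rightarrow> real set \<Rightarrow> real^2 \<Rightarrow> real^2 \<Rightarrow> bool" where
  "parallel_pair \<gamma> S a b \<longleftrightarrow>
     a \<noteq> b \<and>
     (\<exists>s\<in>S. \<exists>t\<in>S. a = \<gamma> s \<and> b = \<gamma> t \<and>
        affine_parallel (tangent_line \<gamma> s) (tangent_line \<gamma> t))"

definition equidistant :: "real \<Rightarrow> (real \<Rightarrow> real^2) \<Rightarrow> real set \<Rightarrow> (real^2) set" where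
  "equidistant l \<gamma> S = {l *\<^sub>R a + (1 - l) *\<^sub>R b | a b. parallel_pair \<gamma> S a b}"

definition wigner_caustic :: "(real \<Rightarrow> real^2) \<Rightarrow> real set \<Rightarrow> (real^2) set" where
  "wigner_caustic = equidistant (1/2)"

section \<open>Singular points\<close>

text \<open>Embedded one-dimensional submanifolds of the plane (without boundary): locally the
  homeomorphic image of an open interval under a \<open>C\<^sup>k\<close> immersion.\<close>

definition Ck_manifold1 :: "enat \<Rightarrow> (real^2) set \<Rightarrow> bool" where
  "Ck_manifold1 k M \<longleftrightarrow>
     (\<forall>p\<in>M. \<exists>U a b h g. open U \<and> p \<in> U \<and> a < b \<and>
        Ck_on k h {a<..<b} \<and>
        (\<forall>u\<in>{a<..<b}. velocity h u \<noteq> 0) \<and>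
        homeomorphism {a<..<b} (M \<inter> U) h g)"

definition Ck_regular_at :: "enat \<Rightarrow> (real \<Rightarrow> real^2) \<Rightarrow> real set \<Rightarrow> real \<Rightarrow> bool" where
  "Ck_regular_at k f J s0 \<longleftrightarrow>
     (\<exists>e>0. {s0 - e<..<s0 + e} \<subseteq> J \<and> Ck_manifold1 k (f ` {s0 - e<..<s0 + e}))"

definition singular_at :: "(real \<Rightarrow> real^2) \<Rightarrow> real set \<Rightarrow> real \<Rightarrow> bool" where
  "singular_at f J s0 \<longleftrightarrow> (\<forall>k>0. \<not> Ck_regular_at k f J s0)"

text \<open>\<open>t\<close> determines the local parameterization
  \<open>s \<mapsto> l \<gamma>(s) + (1 - l) \<gamma>(t(s))\<close>, \<open>s \<in> {c<..<d}\<close>, of the equidistant.\<close>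

definition parallel_branch ::
    "(real \<Rightarrow> real^2) \<Rightarrow> real set \<Rightarrow> real \<Rightarrow> real \<Rightarrow> (real \<Rightarrow> real) \<Rightarrow> bool" where
  "parallel_branch \<gamma> S c d t \<longleftrightarrow>
     {c<..<d} \<subseteq> S \<and> t ` {c<..<d} \<subseteq> S \<and> smooth_on t {c<..<d} \<and>
     (\<forall>s\<in>{c<..<d}. parallel_pair \<gamma> S (\<gamma> s) (\<gamma> (t s)))"

definition equidistant_singular_point ::
    "real \<Rightarrow> (real \<Rightarrow> real^2) \<Rightarrow> real set \<Rightarrow> real^2 \<Rightarrow> bool" where
  "equidistant_singular_point l \<gamma> S p \<longleftrightarrow>
     (\<exists>c d t s0. parallel_branch \<gamma> S c d t \<and> s0 \<in> {c<..<d} \<and>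
        p = l *\<^sub>R \<gamma> s0 + (1 - l) *\<^sub>R \<gamma> (t s0) \<and>
        singular_at (\<lambda>s. l *\<^sub>R \<gamma> s + (1 - l) *\<^sub>R \<gamma> (t s)) {c<..<d} s0)"

end

theory Submission
  imports Defs
begin

text \<open>Parameterize the loop by its tangent angle \<open>x\<close>, so that its derivative is \<open>\<rho>(x)(cos x, sin x)\<close>
  with \<open>\<rho> > 0\<close> the radius of curvature. The branch of the Wigner caustic belonging to the pairs
  \<open>(x, x + \<pi>)\<close> has derivative \<open>(\<rho>(x) - \<rho>(x + \<pi>))/2 (cos x, sin x)\<close>. If its image is a \<open>C\<^sup>1\<close> curve
  near a point, then, as its tangent direction turns strictly, it cannot run back over itself, and
  \<open>\<rho>(x) - \<rho>(x + \<pi>)\<close> does not change sign there; if that difference vanishes on an interval, then the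
  branch is constant there and every point of it is singular. So without singular points one would
  have, say, \<open>\<rho>(x) \<ge> \<rho>(x + \<pi>)\<close> throughout, with strict inequality on a dense set. But then the
  displacement in the normal direction at the starting point is a sum over successive half turns with
  alternating signs and decreasing sizes, hence positive, and the curve does not close up. The total
  turning of the tangent may be arbitrary, even infinite, and simplicity is only used to see that the
  two points of a pair are different.\<close>

section \<open>Calculus of smooth functions\<close>

lemma Cn_on_SucI:
  "(\<And>x. x \<in> S \<Longrightarrow> (f has_vector_derivative f' x) (at x)) \<Longrightarrow> Cn_on n f' S \<Longrightarrow> Cn_on (Suc n) f S"
  unfolding Cn_on.simps by blast

lemma Cn_on_SucE:
  assumes "Cn_on (Suc n) f S"
  obtains f' where "\<forall>x\<in>S. (f has_vector_derivative f' x) (at x)" "Cn_on n f' S"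
  using assms unfolding Cn_on.simps by blast

lemma Cn_on_cong:
  assumes "open S" "\<And>x. x \<in> S \<Longrightarrow> f x = g x" "Cn_on n f S"
  shows "Cn_on n g S"
proof (cases n)
  case 0
  then show ?thesis using assms continuous_on_cong[of S S f g] by simp
next
  case (Suc m)
  with assms(3) obtain f' where f': "\<forall>x\<in>S. (f has_vector_derivative f' x) (at x)" "Cn_on m f' S"
    using Cn_on_SucE by metis
  have "(g has_vector_derivative f' x) (at x)" if "x \<in> S" for x
    using f'(1)[rule_format, OF that] assms(1) that assms(2) by (rule has_vector_derivative_transform_within_open)
  then show ?thesis using f'(2) unfolding Suc by (rule Cn_on_SucI)
qed

lemma Cn_on_SucD: "Cn_on (Suc n) f S \<Longrightarrow> Cn_on n f S"
proof (induction n arbitrary: f)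
  case 0
  then obtain f' where "\<forall>x\<in>S. (f has_vector_derivative f' x) (at x)"
    by (rule Cn_on_SucE)
  then have "\<forall>x\<in>S. isCont f x"
    by (auto intro: has_vector_derivative_continuous)
  then show ?case
    by (simp add: continuous_at_imp_continuous_on)
next
  case (Suc n)
  from Suc.prems obtain f' where f': "\<forall>x\<in>S. (f has_vector_derivative f' x) (at x)"
    "Cn_on (Suc n) f' S" by (rule Cn_on_SucE)
  show ?case using f'(1)[rule_format] Suc.IH[OF f'(2)] by (rule Cn_on_SucI)
qed

lemma Cn_on_const: "Cn_on n (\<lambda>x. c) S"
proof (induction n arbitrary: c)
  case (Suc n)
  show ?case by (rule Cn_on_SucI[OF has_vector_derivative_const Suc])
qed simp

lemma Cn_on_add: "Cn_on n f S \<Longrightarrow> Cn_on n g S \<Longrightarrow> Cn_on n (\<lambda>x. f x + g x) S"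
proof (induction n arbitrary: f g)
  case 0
  then show ?case by (simp add: continuous_on_add)
next
  case (Suc n)
  obtain f' where f: "\<forall>x\<in>S. (f has_vector_derivative f' x) (at x)" "Cn_on n f' S"
    using Suc.prems(1) by (rule Cn_on_SucE)
  obtain g' where g: "\<forall>x\<in>S. (g has_vector_derivative g' x) (at x)" "Cn_on n g' S"
    using Suc.prems(2) by (rule Cn_on_SucE)
  show ?case
    by (rule Cn_on_SucI[OF has_vector_derivative_add[OF f(1)[rule_format] g(1)[rule_format]] Suc.IH[OF f(2) g(2)]])
qed

lemma Cn_on_mult:
  fixes f g :: "real \<Rightarrow> real"
  shows "Cn_on n f S \<Longrightarrow> Cn_on n g S \<Longrightarrow> Cn_on n (\<lambda>x. f x * g x) S"
proof (induction n arbitrary: f g)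
  case 0
  then show ?case by (simp add: continuous_on_mult)
next
  case (Suc n)
  obtain f' where f: "\<forall>x\<in>S. (f has_vector_derivative f' x) (at x)" "Cn_on n f' S"
    using Suc.prems(1) by (rule Cn_on_SucE)
  obtain g' where g: "\<forall>x\<in>S. (g has_vector_derivative g' x) (at x)" "Cn_on n g' S"
    using Suc.prems(2) by (rule Cn_on_SucE)
  have "Cn_on n (\<lambda>x. f x * g' x + f' x * g x) S"
    using Suc.prems[THEN Cn_on_SucD] f(2) g(2) by (intro Cn_on_add Suc.IH)
  moreover have "((\<lambda>x. f x * g x) has_vector_derivative f x * g' x + f' x * g x) (at x)"
    if "x \<in> S" for x
    using f(1) g(1) that by (simp add: has_vector_derivative_mult)
  ultimately show ?case by (rule Cn_on_SucI[rotated])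
qed

lemma Cn_on_diff:
  fixes f g :: "real \<Rightarrow> real"
  assumes "Cn_on n f S" "Cn_on n g S"
  shows "Cn_on n (\<lambda>x. f x - g x) S"
  using Cn_on_add[OF assms(1) Cn_on_mult[OF Cn_on_const[of n "-1"] assms(2)]] by simp

lemma Cn_on_inverse:
  fixes f :: "real \<Rightarrow> real"
  assumes "\<And>x. x \<in> S \<Longrightarrow> f x \<noteq> 0"
  shows "Cn_on n f S \<Longrightarrow> Cn_on n (\<lambda>x. inverse (f x)) S"
proof (induction n)
  case 0
  then show ?case using assms by (simp add: continuous_on_inverse)
next
  case (Suc n)
  obtain f' where f: "\<forall>x\<in>S. (f has_vector_derivative f' x) (at x)" "Cn_on n f' S"
    using Suc.prems(1) by (rule Cn_on_SucE)
  have "Cn_on n (\<lambda>x. (- 1) * (f' x * (inverse (f x) * inverse (f x)))) S"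
    using Suc.IH[OF Suc.prems[THEN Cn_on_SucD]] f(2) by (intro Cn_on_const Cn_on_mult)
  moreover have "((\<lambda>x. inverse (f x)) has_vector_derivative
      (- 1) * (f' x * (inverse (f x) * inverse (f x)))) (at x)" if "x \<in> S" for x
    using DERIV_inverse_fun[of f "f' x" x UNIV] f(1)[rule_format] assms[OF that] that
    by (simp add: algebra_simps flip: has_real_derivative_iff_has_vector_derivative)
  ultimately show ?case by (rule Cn_on_SucI[rotated])
qed

lemma Cn_on_compose:
  fixes f g :: "real \<Rightarrow> real"
  assumes "g ` S \<subseteq> T"
  shows "Cn_on n f T \<Longrightarrow> Cn_on n g S \<Longrightarrow> Cn_on n (\<lambda>x. f (g x)) S"
proof (induction n arbitrary: f)
  case 0
  then show ?case using assms by (auto intro: continuous_on_compose2)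
next
  case (Suc n)
  obtain f' where f: "\<forall>x\<in>T. (f has_vector_derivative f' x) (at x)" "Cn_on n f' T"
    using Suc.prems(1) by (rule Cn_on_SucE)
  obtain g' where g: "\<forall>x\<in>S. (g has_vector_derivative g' x) (at x)" "Cn_on n g' S"
    using Suc.prems(2) by (rule Cn_on_SucE)
  have "Cn_on n (\<lambda>x. g' x * f' (g x)) S"
    by (rule Cn_on_mult[OF g(2) Suc.IH[OF f(2) Suc.prems(2)[THEN Cn_on_SucD]]])
  moreover have "((\<lambda>x. f (g x)) has_vector_derivative g' x * f' (g x)) (at x)" if "x \<in> S" for x
  proof -
    have "g x \<in> T" using that assms by blast
    from vector_diff_chain_at[OF g(1)[rule_format, OF that] f(1)[rule_format, OF this]] show ?thesis by (simp add: o_def)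
  qed
  ultimately show ?case by (rule Cn_on_SucI[rotated])
qed

lemma has_vector_derivative_vec_nth:
  "(f has_vector_derivative f') F \<Longrightarrow> ((\<lambda>x. f x $ i) has_vector_derivative f' $ i) F"
  by (rule bounded_linear.has_vector_derivative[OF bounded_linear_vec_nth])

lemma Cn_on_vec_nth: "Cn_on n f S \<Longrightarrow> Cn_on n (\<lambda>x. f x $ i) S"
proof (induction n arbitrary: f)
  case 0
  then show ?case by (simp add: continuous_on_component)
next
  case (Suc n)
  obtain f' where f: "\<forall>x\<in>S. (f has_vector_derivative f' x) (at x)" "Cn_on n f' S"
    using Suc.prems(1) by (rule Cn_on_SucE)
  show ?case
    by (rule Cn_on_SucI[OF has_vector_derivative_vec_nth[OF f(1)[rule_format]] Suc.IH[OF f(2)]])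
qed

lemma smooth_on_iff: "smooth_on f S \<longleftrightarrow> (\<forall>n. Cn_on n f S)"
  by (simp add: Ck_on_def)

lemma smooth_on_subset:
  assumes "smooth_on f T" "S \<subseteq> T"
  shows "smooth_on f S"
proof -
  have "Cn_on n f T \<Longrightarrow> Cn_on n f S" for n
  proof (induction n arbitrary: f)
    case 0
    then show ?case using assms(2) by (auto intro: continuous_on_subset)
  next
    case (Suc n)
    obtain f' where f: "\<forall>x\<in>T. (f has_vector_derivative f' x) (at x)" "Cn_on n f' T"
      using Suc.prems by (rule Cn_on_SucE)
    show ?case
      by (rule Cn_on_SucI[OF _ Suc.IH[OF f(2)]]) (use f(1) assms(2) in blast)
  qed
  then show ?thesis using assms(1) unfolding smooth_on_iff by blast
qed

text \<open>The derivatives that witness \<open>Cn_on\<close> for different orders agree on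
  \<open>S\<close> by uniqueness, so the single function \<open>vector_derivative\<close> serves for
  all orders at once.\<close>

lemma smooth_on_velocity:
  assumes "open S" "smooth_on f S"
  shows "smooth_on (\<lambda>s. vector_derivative f (at s)) S"
    and "\<And>s. s \<in> S \<Longrightarrow> (f has_vector_derivative vector_derivative f (at s)) (at s)"
proof -
  have smooth: "Cn_on (Suc n) f S" for n
    using assms(2) unfolding smooth_on_iff by (rule spec)
  show "(f has_vector_derivative vector_derivative f (at s)) (at s)" if "s \<in> S" for s
    using smooth[of 0] that 
    by (auto elim!: Cn_on_SucE simp: vector_derivative_at simp del: Cn_on.simps)
  have "Cn_on n (\<lambda>s. vector_derivative f (at s)) S" for n
  proof -
    obtain f' where "\<forall>x\<in>S. (f has_vector_derivative f' x) (at x)" "Cn_on n f' S"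
      using smooth by (rule Cn_on_SucE)
    then show ?thesis
      by (intro Cn_on_cong[OF assms(1) _ \<open>Cn_on n f' S\<close>]) (simp add: vector_derivative_at[symmetric])
  qed
  then show "smooth_on (\<lambda>s. vector_derivative f (at s)) S"
    unfolding smooth_on_iff by blast
qed

text \<open>Bootstrapping: once \<open>t\<close> is of class \<open>C^n\<close>, so is the
  right-hand side \<open>\<phi> s * \<psi> (t s)\<close>, and hence \<open>t\<close> is of class
  \<open>C^(n+1)\<close>. This makes the function that assigns the second point of a parallel pair
  smooth.\<close>

lemma smooth_on_separable_ode:
  fixes t \<phi> \<psi> :: "real \<Rightarrow> real"
  assumes "\<And>s. s \<in> S \<Longrightarrow> (t has_real_derivative \<phi> s * \<psi> (t s)) (at s)"
    and "smooth_on \<phi> S" "smooth_on \<psi> T" "t ` S \<subseteq> T"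
  shows "smooth_on t S"
proof -
  have "Cn_on n t S" for n
  proof (induction n)
    case 0
    then show ?case using assms(1)
      by (auto intro!: continuous_at_imp_continuous_on dest: DERIV_isCont)
  next
    case (Suc n)
    have "Cn_on n (\<lambda>s. \<psi> (t s)) S"
      using assms(3) Cn_on_compose[OF assms(4) _ Suc] unfolding smooth_on_iff by blast
    then have "Cn_on n (\<lambda>s. \<phi> s * \<psi> (t s)) S"
      using assms(2) Cn_on_mult unfolding smooth_on_iff by blast
    with assms(1) show ?case
      unfolding has_real_derivative_iff_has_vector_derivative by (rule Cn_on_SucI)
  qed
  then show ?thesis unfolding smooth_on_iff by blast
qed

section \<open>Regular points of curves with strictly turning tangent\<close>

lemma connected_nonzero_constant_sign:
  fixes f :: "'a::topological_space \<Rightarrow> real"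
  assumes "connected S" "continuous_on S f" "\<And>x. x \<in> S \<Longrightarrow> f x \<noteq> 0"
  shows "(\<forall>x\<in>S. f x > 0) \<or> (\<forall>x\<in>S. f x < 0)"
proof (rule ccontr)
  assume "\<not> ?thesis"
  then obtain x y where "x \<in> S" "y \<in> S" "f x \<le> 0" "0 \<le> f y"
    by (auto simp: not_less)
  moreover have "is_interval (f ` S)"
    using connected_continuous_image[OF assms(2,1)] by (simp add: is_interval_connected_1)
  ultimately have "0 \<in> f ` S" by (meson imageI mem_is_interval_1_I)
  with assms(3) show False by force
qed

definition dir :: "real \<Rightarrow> real^2" where
  "dir x = vector [cos x, sin x]"

lemma dir_nth [simp]: "dir x $ 1 = cos x" "dir x $ 2 = sin x"
  by (simp_all add: dir_def)

lemma dir_pi [simp]: "dir (x + pi) = - dir x"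
  by (simp add: vec_eq_iff forall_2)

lemma norm_dir [simp]: "norm (dir x) = 1"
  by (simp add: norm_vec_def L2_set_def sum_2)

lemma dir_nonzero [simp]: "dir x \<noteq> 0"
  using norm_dir[of x] by (metis norm_zero zero_neq_one)

text \<open>The image is a single point, which is not homeomorphic to a nonempty open interval, so
  it is not a 1-dimensional manifold for any \<open>k\<close>.\<close>

lemma singular_at_const:
  assumes "c < s0" "s0 < d" "\<And>s. s \<in> {c<..<d} \<Longrightarrow> f s = q"
  shows "singular_at f {c<..<d} s0"
  unfolding singular_at_def Ck_regular_at_def
proof (intro allI impI notI, elim exE conjE)
  fix k e assume e: "0 < e" "{s0 - e<..<s0 + e} \<subseteq> {c<..<d}"
    and M: "Ck_manifold1 k (f ` {s0 - e<..<s0 + e})"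
  have img: "f ` {s0 - e<..<s0 + e} = {q}"
  proof -
    have "f s = q" if "s \<in> {s0 - e<..<s0 + e}" for s
      using e(2) that assms(3) by blast
    moreover have "s0 \<in> {s0 - e<..<s0 + e}" using e(1) by simp
    ultimately show ?thesis by blast
  qed
  obtain U h g and a b :: real where "a < b" "homeomorphism {a<..<b} ({q} \<inter> U) h g"
    using M[unfolded img Ck_manifold1_def, rule_format, OF singletonI] by blast
  then have "{a<..<b} = g ` ({q} \<inter> U)"
    unfolding homeomorphism_def by simp
  then have "finite {a<..<b}" by simp
  with \<open>a < b\<close> show False using infinite_Ioo[of a b] by blast
qed

text \<open>In Caratheodory's form \<open>\<phi> z - \<phi> (u s) = P z * (z - u s)\<close>, so the
  difference quotient of \<open>u\<close> is that of the composition divided by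
  \<open>P (u y)\<close>, which tends to \<open>m\<close>. The inner function is only assumed
  continuous; its differentiability is a conclusion. This suits the coordinate of a curve in a chart
  whose inverse is only known to be continuous.\<close>

lemma DERIV_left_cancel:
  fixes \<phi> u :: "real \<Rightarrow> real"
  assumes "isCont u s" "(\<phi> has_real_derivative m) (at (u s))" "m \<noteq> 0"
    and "((\<lambda>y. \<phi> (u y)) has_real_derivative l) (at s)"
  shows "(u has_real_derivative l / m) (at s)"
proof -
  obtain P where P: "\<And>z. \<phi> z - \<phi> (u s) = P z * (z - u s)" "isCont P (u s)" "P (u s) = m"
    using assms(2) unfolding CARAT_DERIV by auto
  have "isCont (\<lambda>y. P (u y)) s"
    using P(2) assms(1) by (rule isCont_o2[rotated])
  then have PT: "((\<lambda>y. P (u y)) \<longlongrightarrow> m) (at s)"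
    using P(3) by (simp add: isCont_def)
  have Q: "((\<lambda>y. (\<phi> (u y) - \<phi> (u s)) / (y - s)) \<longlongrightarrow> l) (at s)"
    using assms(4) by (simp add: has_field_derivative_iff)
  have "((\<lambda>y. (u y - u s) / (y - s)) \<longlongrightarrow> l / m) (at s)"
  proof (rule Lim_transform_eventually[OF tendsto_divide[OF Q PT assms(3)]])
    have "\<forall>\<^sub>F y in at s. P (u y) \<noteq> 0"
      using PT assms(3) by (rule tendsto_imp_eventually_ne)
    then show "\<forall>\<^sub>F y in at s. (\<phi> (u y) - \<phi> (u s)) / (y - s) / P (u y) = (u y - u s) / (y - s)"
      by eventually_elim (simp add: P(1))
  qed
  then show ?thesis by (simp add: has_field_derivative_iff)
qed

text \<open>In a chart \<open>h\<close> of the image, \<open>f\<close> has a coordinate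
  \<open>u\<close>. A value of \<open>u\<close> determines the tangent line of the image up to
  translation; as the angle \<theta> is injective, \<open>u\<close> is injective too, hence
  monotone. Thus \<open>u'\<close>, and with it \<open>G\<close>, keeps a weak sign near
  \<open>s0\<close>.\<close>

lemma locally_one_signed:
  fixes f :: "real \<Rightarrow> real^2"
  assumes s0: "s0 \<in> {c<..<d}"
    and deriv: "\<And>s. s \<in> {c<..<d} \<Longrightarrow> (f has_vector_derivative G s *\<^sub>R dir (\<theta> s)) (at s)"
    and cont: "continuous_on {c<..<d} \<theta>" and inj: "inj_on \<theta> {c<..<d}"
    and dense: "\<And>a b. c \<le> a \<Longrightarrow> a < b \<Longrightarrow> b \<le> d \<Longrightarrow> \<exists>s\<in>{a<..<b}. G s \<noteq> 0"
    and reg: "\<not> singular_at f {c<..<d} s0"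
  obtains \<delta> where "\<delta> > 0" "ball s0 \<delta> \<subseteq> {c<..<d}"
    "(\<forall>s\<in>ball s0 \<delta>. 0 \<le> G s) \<or> (\<forall>s\<in>ball s0 \<delta>. G s \<le> 0)"
proof -
  obtain k e where k: "k > 0" and e: "e > 0" "{s0 - e<..<s0 + e} \<subseteq> {c<..<d}"
    and M: "Ck_manifold1 k (f ` {s0 - e<..<s0 + e})"
    using reg unfolding singular_at_def Ck_regular_at_def by blast
  define E where "E = {s0 - e<..<s0 + e}"
  have s0E: "s0 \<in> E" using e(1) by (simp add: E_def)
  have ED: "E \<subseteq> {c<..<d}" using e(2) by (simp add: E_def)
  have "f s0 \<in> f ` E" using s0E by blast
  from bspec[OF M[folded E_def, unfolded Ck_manifold1_def] this] obtain U h g and a b :: real where U: "open U" "f s0 \<in> U" and hk: "Ck_on k h {a<..<b}"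
    and hv: "\<forall>v\<in>{a<..<b}. velocity h v \<noteq> 0"
    and hom: "homeomorphism {a<..<b} (f ` E \<inter> U) h g"
    by blast
  have "Cn_on (Suc 0) h {a<..<b}"
  proof -
    \<comment> \<open>A positive extended natural number is at least 1, so the chart is at least
      \<open>C^1\<close> whatever \<open>k\<close> is.\<close>
    have "enat (Suc 0) \<le> k" using k by (metis One_nat_def eSuc_enat ileI1 one_eSuc one_enat_def zero_enat_def)
    then show ?thesis using hk unfolding Ck_on_def by blast
  qed
  then obtain h' where h': "\<forall>v\<in>{a<..<b}. (h has_vector_derivative h' v) (at v)"
    and h'c: "continuous_on {a<..<b} h'"
    unfolding Cn_on.simps by blast
  have h'0: "h' v \<noteq> 0" if "v \<in> {a<..<b}" for v
    using that hv h' vector_derivative_at by metis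
  have fcont: "continuous_on E f"
    using ED deriv has_vector_derivative_continuous by (meson continuous_at_imp_continuous_on subsetD)
  have openE: "open E" by (simp add: E_def)
  have "open (E \<inter> f -` U)"
    using continuous_open_preimage[OF fcont openE U(1)] .
  \<comment> \<open>The radius \<open>pi/2\<close> keeps any two angles on the neighbourhood less
    than \<open>pi\<close> apart, so that directions equal up to sign have equal angles.\<close>
  moreover have "open (E \<inter> \<theta> -` ball (\<theta> s0) (pi/2))"
    by (rule continuous_open_preimage[OF continuous_on_subset[OF cont ED] openE open_ball])
  ultimately have "open ((E \<inter> f -` U) \<inter> (E \<inter> \<theta> -` ball (\<theta> s0) (pi/2)))"
    by (rule open_Int)
  moreover have "s0 \<in> (E \<inter> f -` U) \<inter> (E \<inter> \<theta> -` ball (\<theta> s0) (pi/2))"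
    using s0E U(2) by simp
  ultimately obtain \<delta> where \<delta>: "\<delta> > 0"
    "ball s0 \<delta> \<subseteq> (E \<inter> f -` U) \<inter> (E \<inter> \<theta> -` ball (\<theta> s0) (pi/2))"
    by (meson open_contains_ball)
  define B where "B = ball s0 \<delta>"
  have BE: "B \<subseteq> E" and BU: "\<And>s. s \<in> B \<Longrightarrow> f s \<in> U"
    using \<delta>(2) unfolding B_def by blast+
  have B\<theta>: "\<bar>\<theta> s - \<theta> s0\<bar> < pi/2" if "s \<in> B" for s
  proof -
    have "\<theta> s \<in> ball (\<theta> s0) (pi/2)" using that \<delta>(2) unfolding B_def by blast
    then show ?thesis by (simp add: dist_real_def abs_minus_commute)
  qed
  have BD: "B \<subseteq> {c<..<d}" using BE ED by blast
  have openB: "open B" and connB: "connected B"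
    by (simp_all add: B_def)
  define u where "u s = g (f s)" for s
  have hu: "h (u s) = f s" and uab: "u s \<in> {a<..<b}" if "s \<in> B" for s
  proof -
    have *: "f s \<in> f ` E \<inter> U" using that BE BU by blast
    show "h (u s) = f s" using hom * unfolding u_def homeomorphism_def by blast
    show "u s \<in> {a<..<b}" using hom * unfolding u_def homeomorphism_def by blast
  qed
  have ucont: "continuous_on B u"
  proof -
    have "continuous_on (f ` E \<inter> U) g" using hom unfolding homeomorphism_def by blast
    moreover have "f ` B \<subseteq> f ` E \<inter> U" using BE BU by blast
    ultimately show ?thesis
      unfolding u_def using continuous_on_compose2 continuous_on_subset[OF fcont BE] by blast
  qed
  have "\<exists>l. (u has_real_derivative l) (at s)" if s: "s \<in> B" for s
  proof -
    \<comment> \<open>Pairing with the chart velocity \<open>w\<close> reduces the claim to real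
      functions: the derivative of \<open>h v \<bullet> w\<close> at \<open>u s\<close> is
      \<open>w \<bullet> w\<close>, which is nonzero, so \<open>u\<close> inherits differentiability
      from \<open>f y \<bullet> w\<close>.\<close>
    define w where "w = h' (u s)"
    have w: "w \<noteq> 0" using h'0 uab[OF s] by (simp add: w_def)
    have "isCont u s" using ucont openB s by (simp add: continuous_on_eq_continuous_at)
    moreover have "((\<lambda>v. h v \<bullet> w) has_real_derivative w \<bullet> w) (at (u s))"
      using bounded_linear.has_vector_derivative[OF bounded_linear_inner_left h'[rule_format, OF uab[OF s]]]
      unfolding has_real_derivative_iff_has_vector_derivative by (simp add: w_def)
    moreover have "w \<bullet> w \<noteq> 0" using w by simp
    moreover have "((\<lambda>y. h (u y) \<bullet> w) has_real_derivative (G s *\<^sub>R dir (\<theta> s)) \<bullet> w) (at s)"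
      unfolding has_real_derivative_iff_has_vector_derivative
    proof (rule has_vector_derivative_transform_within_open[OF _ openB s])
      show "((\<lambda>y. f y \<bullet> w) has_vector_derivative (G s *\<^sub>R dir (\<theta> s)) \<bullet> w) (at s)"
        using bounded_linear.has_vector_derivative[OF bounded_linear_inner_left deriv] s BD by blast
    qed (simp add: hu)
    ultimately show ?thesis by (blast intro: DERIV_left_cancel)
  qed
  then obtain u' where u': "\<And>s. s \<in> B \<Longrightarrow> (u has_real_derivative u' s) (at s)"
    by metis
  have chain: "G s *\<^sub>R dir (\<theta> s) = u' s *\<^sub>R h' (u s)" if s: "s \<in> B" for s
  proof (rule vector_derivative_unique_at)
    show "(f has_vector_derivative G s *\<^sub>R dir (\<theta> s)) (at s)"
      using deriv s BD by blast
    have "((h \<circ> u) has_vector_derivative u' s *\<^sub>R h' (u s)) (at s)"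
      using vector_diff_chain_at[of u "u' s" s h] u'[OF s] h' uab[OF s]
      by (simp add: has_real_derivative_iff_has_vector_derivative)
    then show "(f has_vector_derivative u' s *\<^sub>R h' (u s)) (at s)"
      by (rule has_vector_derivative_transform_within_open[OF _ openB s]) (simp add: hu)
  qed
  have huc: "continuous_on B (\<lambda>s. h' (u s))"
    using continuous_on_compose2[OF h'c ucont] uab by blast
  have \<theta>c: "continuous_on B \<theta>" using cont BD by (rule continuous_on_subset)
  \<comment> \<open>Where \<open>G\<close> is nonzero, the chain rule makes \<open>h' (u s)\<close>
    parallel to \<open>dir (\<theta> s)\<close>. Failure to be parallel is an open condition, so it
    would hold on a whole interval, and there \<open>G\<close> has a nonzero value by
    \<open>dense\<close>.\<close>
  have par: "h' (u s) $ 1 * sin (\<theta> s) = h' (u s) $ 2 * cos (\<theta> s)" if s: "s \<in> B" for s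
  proof (rule ccontr)
    define \<kappa> where "\<kappa> s = h' (u s) $ 1 * sin (\<theta> s) - h' (u s) $ 2 * cos (\<theta> s)" for s
    assume "\<not> ?thesis"
    then have "\<kappa> s \<noteq> 0" by (simp add: \<kappa>_def)
    have "continuous_on B \<kappa>"
      unfolding \<kappa>_def by (intro continuous_intros huc \<theta>c)
    then have "open (B \<inter> \<kappa> -` (- {0}))"
      using openB by (rule continuous_open_preimage) (simp add: open_Compl)
    moreover have "s \<in> B \<inter> \<kappa> -` (- {0})" using s \<open>\<kappa> s \<noteq> 0\<close> by simp
    ultimately obtain r where r: "r > 0" "ball s r \<subseteq> B \<inter> \<kappa> -` (- {0})"
      by (meson open_contains_ball)
    have "{s - r<..<s + r} = ball s r" by (simp add: ball_eq_greaterThanLessThan)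
    have sub: "{s - r<..<s + r} \<subseteq> {c<..<d}"
      using r(2) BD unfolding ball_eq_greaterThanLessThan by blast
    have "c \<le> s - r" "s + r \<le> d"
      using sub r(1) greaterThanLessThan_subseteq_greaterThanLessThan[of "s - r" "s + r" c d] by auto
    then obtain y where y: "y \<in> {s - r<..<s + r}" "G y \<noteq> 0"
      using dense[of "s - r" "s + r"] r(1) by auto
    then have yB: "y \<in> B" "\<kappa> y \<noteq> 0" using r(2) unfolding ball_eq_greaterThanLessThan by auto
    have eq: "G y * cos (\<theta> y) = u' y * h' (u y) $ 1" "G y * sin (\<theta> y) = u' y * h' (u y) $ 2"
      using arg_cong[OF chain[OF yB(1)], of "\<lambda>v. v $ 1"] arg_cong[OF chain[OF yB(1)], of "\<lambda>v. v $ 2"]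
      by simp_all
    have "G y * \<kappa> y = h' (u y) $ 1 * (G y * sin (\<theta> y)) - h' (u y) $ 2 * (G y * cos (\<theta> y))"
      unfolding \<kappa>_def by (simp add: algebra_simps)
    also have "\<dots> = 0" unfolding eq by simp
    finally show False using y(2) yB(2) by simp
  qed
  \<comment> \<open>The signed length of \<open>h' (u s)\<close> along the tangent direction. It is
    continuous and nowhere zero, so it has constant sign, and the sign of
    \<open>G s = u' s * \<eta> s\<close> is governed by that of \<open>u' s\<close>.\<close>
  define \<eta> where "\<eta> s = h' (u s) \<bullet> dir (\<theta> s)" for s
  have \<eta>_eq: "\<eta> s = h' (u s) $ 1 * cos (\<theta> s) + h' (u s) $ 2 * sin (\<theta> s)" for s
    by (simp add: \<eta>_def inner_vec_def sum_2)
  have h'_eq: "h' (u s) = \<eta> s *\<^sub>R dir (\<theta> s)" if "s \<in> B" for s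
  proof -
    have "\<eta> s * cos (\<theta> s) = h' (u s) $ 1 * ((cos (\<theta> s))\<^sup>2 + (sin (\<theta> s))\<^sup>2)"
      unfolding \<eta>_eq using par[OF that] by algebra
    moreover have "\<eta> s * sin (\<theta> s) = h' (u s) $ 2 * ((cos (\<theta> s))\<^sup>2 + (sin (\<theta> s))\<^sup>2)"
      unfolding \<eta>_eq using par[OF that] by algebra
    ultimately show ?thesis by (simp add: vec_eq_iff forall_2)
  qed
  have \<eta>0: "\<eta> s \<noteq> 0" if "s \<in> B" for s
    using h'_eq[OF that] h'0[OF uab[OF that]] by auto
  have G_eq: "G s = u' s * \<eta> s" if "s \<in> B" for s
    using chain[OF that] unfolding h'_eq[OF that] by simp
  have "continuous_on B \<eta>"
    unfolding \<eta>_eq by (intro continuous_intros huc \<theta>c)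
  then have \<eta>sgn: "(\<forall>s\<in>B. \<eta> s > 0) \<or> (\<forall>s\<in>B. \<eta> s < 0)"
    using connected_nonzero_constant_sign[OF connB] \<eta>0 by blast
  \<comment> \<open>Equal coordinates give equal chart velocities, hence directions equal up to
    sign; angles less than \<open>pi\<close> apart then coincide.\<close>
  have "inj_on u B"
  proof (rule inj_onI)
    fix s s' assume s: "s \<in> B" "s' \<in> B" and "u s = u s'"
    then have "\<eta> s *\<^sub>R dir (\<theta> s) = \<eta> s' *\<^sub>R dir (\<theta> s')"
      using h'_eq by metis
    then have eq: "\<eta> s * cos (\<theta> s) = \<eta> s' * cos (\<theta> s')" "\<eta> s * sin (\<theta> s) = \<eta> s' * sin (\<theta> s')"
      by (simp_all add: vec_eq_iff forall_2)
    have "\<eta> s * sin (\<theta> s - \<theta> s') = (\<eta> s * sin (\<theta> s)) * cos (\<theta> s') - (\<eta> s * cos (\<theta> s)) * sin (\<theta> s')"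
      by (simp add: sin_diff algebra_simps)
    also have "\<dots> = 0" unfolding eq by simp
    finally have "sin (\<theta> s - \<theta> s') = 0" using \<eta>0 s by simp
    moreover have "\<bar>\<theta> s - \<theta> s'\<bar> < pi" using B\<theta>[OF s(1)] B\<theta>[OF s(2)] by linarith
    ultimately have "\<theta> s = \<theta> s'" using sin_eq_0_pi[of "\<theta> s - \<theta> s'"] by linarith
    then show "s = s'" using inj s BD unfolding inj_on_def by blast
  qed
  then have "strict_mono_on B u \<or> strict_antimono_on B u"
    using injective_eq_monotone_map[OF _ ucont] connB is_interval_connected_1 by blast
  then have "(\<forall>s\<in>B. u' s \<ge> 0) \<or> (\<forall>s\<in>B. u' s \<le> 0)"
  proof
    assume "strict_mono_on B u"
    then have "mono_on B u" by (simp add: strict_mono_on_imp_mono_on)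
    then have "\<forall>s\<in>B. u' s \<ge> 0"
      using mono_on_imp_deriv_nonneg u' openB by (metis interior_open)
    then show ?thesis ..
  next
    assume "strict_antimono_on B u"
    then have "mono_on B (\<lambda>s. - u s)"
      unfolding monotone_on_def by (force simp: order_le_less)
    moreover have "((\<lambda>s. - u s) has_real_derivative - u' s) (at s)" if "s \<in> B" for s
      using u'[OF that] by (rule DERIV_minus)
    ultimately have "\<forall>s\<in>B. - u' s \<ge> 0"
      using mono_on_imp_deriv_nonneg[of B "\<lambda>s. - u s"] openB by (metis interior_open)
    then show ?thesis by simp
  qed
  then have "(\<forall>s\<in>B. G s \<ge> 0) \<or> (\<forall>s\<in>B. G s \<le> 0)"
    using \<eta>sgn unfolding Ball_def
    by (metis G_eq less_eq_real_def mult_nonneg_nonneg mult_nonneg_nonpos mult_nonpos_nonneg mult_nonpos_nonpos)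
  then show thesis using that[OF \<delta>(1)] BD unfolding B_def by blast
qed

section \<open>Curves with monotone radius of curvature do not close up\<close>

lemma sin_pos_between: "a < x \<Longrightarrow> x < a + pi \<Longrightarrow> sin (x - a) > 0" for a x :: real
  by (intro sin_gt_zero) auto

lemma sin_shift: "sin (x - (a + 2 * pi)) = sin (x - a)" for a x :: real
  using sin_periodic[of "x - (a + 2 * pi)"] by simp

text \<open>Here \<open>N\<close> models the height of a curve with radius of curvature \<rho> above
  a line of direction angle \<open>a\<close>. The sine changes sign after half a turn, so in the sum
  of the heights at opposite angles the two radii are subtracted.\<close>

lemma half_turn_sum_deriv:
  assumes "(N has_real_derivative \<rho> x * sin (x - a)) (at x)"
    and "(N has_real_derivative \<rho> (x + pi) * sin (x + pi - a)) (at (x + pi))"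
  shows "((\<lambda>x. N x + N (x + pi)) has_real_derivative (\<rho> x - \<rho> (x + pi)) * sin (x - a)) (at x)"
proof -
  have "((\<lambda>x. N (x + pi)) has_real_derivative \<rho> (x + pi) * sin (x + pi - a)) (at x)"
    using assms(2) by (simp add: DERIV_shift)
  moreover have "sin (x + pi - a) = - sin (x - a)"
    using sin_periodic_pi[of "x - a"] by (simp add: algebra_simps)
  ultimately show ?thesis
    using DERIV_add[OF assms(1)] by (fastforce simp: algebra_simps)
qed

text \<open>On the half turn following \<open>a\<close> the sine is nonnegative, so the derivative
  of the sum has the sign of \<open>\<rho> x - \<rho> (x + pi)\<close>.\<close>

lemma half_turn_sum_mono:
  assumes "a \<le> x" "x \<le> y" "y \<le> a + pi" "continuous_on {a..y + pi} N"
    and deriv: "\<And>x. a < x \<Longrightarrow> x < y + pi \<Longrightarrow> (N has_real_derivative \<rho> x * sin (x - a)) (at x)"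
    and dec: "\<And>x. a < x \<Longrightarrow> x < y \<Longrightarrow> \<rho> (x + pi) \<le> \<rho> x"
  shows "N x + N (x + pi) \<le> N y + N (y + pi)"
proof (rule DERIV_nonneg_imp_increasing_open[where f = "\<lambda>x. N x + N (x + pi)"])
  show "x \<le> y" by fact
  show "continuous_on {x..y} (\<lambda>x. N x + N (x + pi))"
    using assms(1-3) pi_ge_two
    by (intro continuous_on_add continuous_on_compose2[OF assms(4), of _ "\<lambda>x. x + pi"]
        continuous_on_subset[OF assms(4)] continuous_intros) auto
  fix z assume z: "x < z" "z < y"
  have "((\<lambda>x. N x + N (x + pi)) has_real_derivative (\<rho> z - \<rho> (z + pi)) * sin (z - a)) (at z)"
    using z assms(1) pi_ge_two by (intro half_turn_sum_deriv deriv) auto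
  moreover have "0 \<le> (\<rho> z - \<rho> (z + pi)) * sin (z - a)"
    using z assms(1,3) dec[of z] sin_pos_between[of a z] by (intro mult_nonneg_nonneg) auto
  ultimately show "\<exists>l. ((\<lambda>x. N x + N (x + pi)) has_real_derivative l) (at z) \<and> 0 \<le> l" by blast
qed

lemma first_half_turn_increasing:
  fixes a x y :: real
  assumes "a \<le> x" "x < y" "y \<le> a + pi" "continuous_on {a..y} N"
    and deriv: "\<And>x. a < x \<Longrightarrow> x < y \<Longrightarrow> (N has_real_derivative \<rho> x * sin (x - a)) (at x)"
    and pos: "\<And>x. a < x \<Longrightarrow> x < y \<Longrightarrow> 0 < \<rho> x"
  shows "N x < N y"
proof (rule DERIV_pos_imp_increasing_open[OF assms(2)])
  show "continuous_on {x..y} N"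
    using assms(1) by (intro continuous_on_subset[OF assms(4)]) auto
  fix z assume z: "x < z" "z < y"
  then show "\<exists>l. (N has_real_derivative l) (at z) \<and> 0 < l"
    using assms(1,3) deriv[of z] pos[of z] sin_pos_between[of a z] by (meson le_less_trans less_le_trans mult_pos_pos)
qed

text \<open>Over each half turn the contributions to \<open>N\<close> alternate in sign and decrease in size.\<close>

lemma decreasing_radius_height:
  fixes a b :: real
  assumes "a \<le> b" "continuous_on {a..b} N"
    and "\<And>x. a < x \<Longrightarrow> x < b \<Longrightarrow> (N has_real_derivative \<rho> x * sin (x - a)) (at x)"
    and "\<And>x. a < x \<Longrightarrow> x < b \<Longrightarrow> 0 < \<rho> x"
    and "\<And>x. a < x \<Longrightarrow> x + pi < b \<Longrightarrow> \<rho> (x + pi) \<le> \<rho> x"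
  shows "N a \<le> N b"
proof -
  obtain n :: nat where "b - a \<le> of_nat n * (2 * pi)"
    using real_arch_simple[of "(b - a) / (2 * pi)"] by (auto simp: field_simps)
  then show ?thesis using assms
  proof (induction n arbitrary: a)
    case 0
    then show ?case by simp
  next
    case (Suc n)
    \<comment> \<open>Within one full turn: on the first half the height increases. Beyond it,
      monotonicity of the sum gives \<open>N a + N (a + pi) \<le> N (y - pi) + N y\<close>, and
      \<open>N (y - pi) \<le> N (a + pi)\<close> because both angles lie in the first half.\<close>
    have small: "N a \<le> N y" if y: "a \<le> y" "y \<le> a + 2 * pi" "y \<le> b" for y
    proof (cases "y \<le> a + pi")
      case True
      show ?thesis
      proof (cases "a = y")
        case False
        have "N a < N y"
          by (rule first_half_turn_increasing[of a _ _ _ \<rho>])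
            (use True False y Suc.prems pi_ge_two in \<open>auto intro: continuous_on_subset\<close>)
        then show ?thesis by simp
      qed simp
    next
      case False
      have "N a + N (a + pi) \<le> N (y - pi) + N (y - pi + pi)"
        by (rule half_turn_sum_mono[of a _ _ _ \<rho>])
          (use False y Suc.prems pi_ge_two in \<open>auto intro: continuous_on_subset\<close>)
      moreover have "N (y - pi) \<le> N (a + pi)"
      proof (cases "y - pi = a + pi")
        case True
        then show ?thesis by (simp only: order_refl)
      next
        case False
        have "N (y - pi) < N (a + pi)"
          by (rule first_half_turn_increasing[of a _ _ _ \<rho>])
            (use False \<open>\<not> y \<le> a + pi\<close> y Suc.prems pi_ge_two in \<open>auto intro: continuous_on_subset\<close>)
        then show ?thesis by simp
      qed
      ultimately show ?thesis by simp
    qed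
    show ?case
    proof (cases "b \<le> a + 2 * pi")
      case True
      then show ?thesis using small[of b] Suc.prems(2) by simp
    next
      case False
      \<comment> \<open>The weight \<open>sin (x - a)\<close> repeats after a full turn, so the
        induction over the number of full turns restarts at \<open>a + 2 * pi\<close>.\<close>
      have "N (a + 2 * pi) \<le> N b"
      proof (rule Suc.IH)
        show "b - (a + 2 * pi) \<le> real n * (2 * pi)"
          using Suc.prems(1) by (simp add: algebra_simps)
        show "continuous_on {a + 2 * pi..b} N"
          by (rule continuous_on_subset[OF Suc.prems(3)]) auto
        show "(N has_real_derivative \<rho> x * sin (x - (a + 2 * pi))) (at x)" if "a + 2 * pi < x" "x < b" for x
          unfolding sin_shift using Suc.prems(4)[of x] that pi_ge_two by simp
        show "0 < \<rho> x" if "a + 2 * pi < x" "x < b" for x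
          using Suc.prems(5)[of x] that pi_ge_two by simp
        show "\<rho> (x + pi) \<le> \<rho> x" if "a + 2 * pi < x" "x + pi < b" for x
          using Suc.prems(6)[of x] that pi_ge_two by simp
      qed (use False in simp)
      moreover have "N a \<le> N (a + 2 * pi)" using small False by simp
      ultimately show ?thesis by simp
    qed
  qed
qed


lemma DERIV_of_zero_on_open:
  fixes f :: "real \<Rightarrow> real"
  assumes "open I" "x \<in> I" "\<And>y. y \<in> I \<Longrightarrow> f y = 0" "(f has_real_derivative l) (at x)"
  shows "l = 0"
proof -
  have "((\<lambda>_. 0) has_real_derivative l) (at x)"
    using assms(4,1,2,3) by (rule has_field_derivative_transform_within_open)
  then show ?thesis using DERIV_const[of 0] DERIV_unique by blast
qed

text \<open>In the normal direction at any angle the curve never ends lower than it starts, and a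
  common limit at both ends forces the total gain to vanish. This is refuted separately for ranges
  of angles without and with a lower bound. The conditions \<open>left\<close> and
  \<open>right\<close> express convergence at the ends of \<open>I\<close>, whether finite or
  infinite.\<close>

lemma decreasing_radius_not_closed:
  fixes X Y \<rho> :: "real \<Rightarrow> real"
  assumes I: "open I" "connected I" "I \<noteq> {}"
    and derX: "\<And>x. x \<in> I \<Longrightarrow> (X has_real_derivative \<rho> x * cos x) (at x)"
    and derY: "\<And>x. x \<in> I \<Longrightarrow> (Y has_real_derivative \<rho> x * sin x) (at x)"
    and pos: "\<And>x. x \<in> I \<Longrightarrow> 0 < \<rho> x"
    and dec: "\<And>x. x \<in> I \<Longrightarrow> x + pi \<in> I \<Longrightarrow> \<rho> (x + pi) \<le> \<rho> x"
    and strict: "\<And>a b. a < b \<Longrightarrow> \<forall>x\<in>{a<..<b}. x \<in> I \<and> x + pi \<in> I \<Longrightarrow> \<exists>x\<in>{a<..<b}. \<rho> (x + pi) \<noteq> \<rho> x"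
    and left: "\<And>e. e > 0 \<Longrightarrow> \<exists>a\<in>I. \<forall>x\<in>I. x \<le> a \<longrightarrow> \<bar>X x - p\<bar> < e \<and> \<bar>Y x - q\<bar> < e"
    and right: "\<And>e. e > 0 \<Longrightarrow> \<exists>b\<in>I. \<forall>x\<in>I. b \<le> x \<longrightarrow> \<bar>X x - p\<bar> < e \<and> \<bar>Y x - q\<bar> < e"
  shows False
proof -
  define N where "N a x = cos a * Y x - sin a * X x" for a x
  \<comment> \<open>The height of the common limit point \<open>(p, q)\<close> in the normal
    direction at \<open>a\<close>, to be compared with the height \<open>N a x\<close> of the
    curve.\<close>
  define P where "P a = cos a * q - sin a * p" for a
  have ivl: "x \<in> I" if "a \<in> I" "b \<in> I" "a \<le> x" "x \<le> b" for a b x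
    using I(2) that unfolding is_interval_connected_1[symmetric] is_interval_1 by blast
  have derN: "(N a has_real_derivative \<rho> x * sin (x - a)) (at x)" if "x \<in> I" for a x
  proof -
    have "(N a has_real_derivative cos a * (\<rho> x * sin x) - sin a * (\<rho> x * cos x)) (at x)"
      unfolding N_def by (intro DERIV_diff DERIV_cmult derX derY that)
    then show ?thesis by (simp add: sin_diff algebra_simps)
  qed
  have NP: "\<bar>N a x - P a\<bar> < 2 * e" if "\<bar>X x - p\<bar> < e" "\<bar>Y x - q\<bar> < e" for a x e
  proof -
    have "N a x - P a = cos a * (Y x - q) - sin a * (X x - p)"
      by (simp add: N_def P_def algebra_simps)
    then have "\<bar>N a x - P a\<bar> \<le> \<bar>cos a\<bar> * \<bar>Y x - q\<bar> + \<bar>sin a\<bar> * \<bar>X x - p\<bar>"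
      by (metis abs_mult abs_triangle_ineq4)
    also have "\<dots> \<le> 1 * \<bar>Y x - q\<bar> + 1 * \<bar>X x - p\<bar>"
      by (intro add_mono mult_right_mono) auto
    also have "\<dots> < e + e" using that by simp
    finally show ?thesis by simp
  qed
  have N_shift: "N (a + 2 * pi) x = N a x" "P (a + 2 * pi) = P a" for a x
    by (simp_all add: N_def P_def)
  have height: "N a a \<le> N a b" if "a \<in> I" "b \<in> I" "a \<le> b" for a b
  proof (rule decreasing_radius_height[OF that(3), where \<rho> = \<rho>])
    have sub: "x \<in> I" if "a \<le> x" "x \<le> b" for x
      using ivl that \<open>a \<in> I\<close> \<open>b \<in> I\<close> by blast
    show "continuous_on {a..b} (N a)"
      using sub DERIV_isCont[OF derN] by (intro continuous_at_imp_continuous_on) auto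
    show "(N a has_real_derivative \<rho> x * sin (x - a)) (at x)" if "a < x" "x < b" for x
      using derN sub that by simp
    show "0 < \<rho> x" if "a < x" "x < b" for x
      using pos sub that by simp
    show "\<rho> (x + pi) \<le> \<rho> x" if "a < x" "x + pi < b" for x
      using that pi_ge_two by (intro dec sub) auto
  qed
  have below_end: "N a a \<le> P a" if a: "a \<in> I" for a
  proof (rule field_le_epsilon)
    fix e :: real assume "e > 0"
    then obtain b where b: "b \<in> I" "\<forall>x\<in>I. b \<le> x \<longrightarrow> \<bar>X x - p\<bar> < e/2 \<and> \<bar>Y x - q\<bar> < e/2"
      using right[of "e/2"] by auto
    have m: "max a b \<in> I" using a b(1) by (simp add: max_def)
    have "\<bar>N a (max a b) - P a\<bar> < 2 * (e/2)"
      using b(2) m by (intro NP) auto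
    then show "N a a \<le> P a + e" using height[OF a m] by simp
  qed
  show False
  proof (cases "bdd_below I")
    case False
    have down: "x \<in> I" if "a \<in> I" "x \<le> a" for a x
    proof -
      obtain y where "y \<in> I" "y < x" using False unfolding bdd_below_def by (meson not_le)
      then show ?thesis using ivl[of y a x] that by simp
    qed
    \<comment> \<open>Going back by a full turn leaves the normal direction unchanged and cannot
      raise the starting height, so the gap to the height of \<open>(p, q)\<close> does not
      shrink.\<close>
    have step: "P a - N a a \<le> P (a - real k * (2 * pi)) - N (a - real k * (2 * pi)) (a - real k * (2 * pi))"
      if a: "a \<in> I" for a k
    proof (induction k)
      case (Suc k)
      define c where "c = a - real (Suc k) * (2 * pi)"
      have c: "c + 2 * pi = a - real k * (2 * pi)" by (simp add: c_def algebra_simps)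
      have "c + 2 * pi \<in> I" unfolding c using pi_ge_two by (intro down[OF a]) simp
      moreover from this have "c \<in> I" using pi_ge_two by (intro down[of "c + 2 * pi" c]) auto
      ultimately have "N c c \<le> N c (c + 2 * pi)" using pi_ge_two by (intro height) auto
      then have "P (c + 2 * pi) - N (c + 2 * pi) (c + 2 * pi) \<le> P c - N c c"
        unfolding N_shift by simp
      then show ?case using Suc unfolding c[symmetric] c_def[symmetric] by simp
    qed simp
    \<comment> \<open>The gap is nonnegative by \<open>below_end\<close> and is bounded by the gap
      after arbitrarily many turns back, which becomes arbitrarily small since the curve tends to
      \<open>(p, q)\<close>. So every tangent line passes through \<open>(p, q)\<close>.\<close>
    have Z: "cos a * (Y a - q) - sin a * (X a - p) = 0" if a: "a \<in> I" for a
    proof -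
      have "P a - N a a \<le> 0 + e" if "e > 0" for e
      proof -
        obtain c where c: "c \<in> I" "\<forall>x\<in>I. x \<le> c \<longrightarrow> \<bar>X x - p\<bar> < e/2 \<and> \<bar>Y x - q\<bar> < e/2"
          using left[of "e/2"] \<open>e > 0\<close> by auto
        obtain k :: nat where "(a - c) / (2 * pi) \<le> real k" using real_arch_simple by blast
        then have k: "a - real k * (2 * pi) \<le> c" by (simp add: field_simps)
        then have "a - real k * (2 * pi) \<in> I" using down c(1) by blast
        then have "\<bar>N (a - real k * (2 * pi)) (a - real k * (2 * pi)) - P (a - real k * (2 * pi))\<bar> < 2 * (e/2)"
          using c(2) k by (intro NP) auto
        then show ?thesis using step[OF a, of k] by linarith
      qed
      then have "P a - N a a \<le> 0" by (rule field_le_epsilon)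
      then have "N a a = P a" using below_end[OF a] by simp
      then show ?thesis by (simp add: N_def P_def algebra_simps)
    qed
    \<comment> \<open>Differentiating the identity \<open>Z\<close>, the terms with \<rho> cancel
      and the component along the tangent vanishes as well. Differentiating once more yields
      \<open>\<rho> a = 0\<close>, against positivity.\<close>
    have V: "sin a * (Y a - q) + cos a * (X a - p) = 0" if a: "a \<in> I" for a
    proof -
      have "((\<lambda>a. cos a * (Y a - q) - sin a * (X a - p)) has_real_derivative
          - (sin a * (Y a - q) + cos a * (X a - p))) (at a)"
        by (rule derivative_eq_intros derX[OF a] derY[OF a] refl | simp add: algebra_simps)+
      from DERIV_of_zero_on_open[OF I(1) a _ this] Z show ?thesis by simp
    qed
    obtain a where a: "a \<in> I" using I(3) by blast
    have "((\<lambda>a. sin a * (Y a - q) + cos a * (X a - p)) has_real_derivative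
        (cos a * (Y a - q) + sin a * (\<rho> a * sin a)) + (- sin a * (X a - p) + cos a * (\<rho> a * cos a))) (at a)"
      by (rule derivative_eq_intros derX[OF a] derY[OF a] refl | simp)+
    from DERIV_of_zero_on_open[OF I(1) a V this]
    have "cos a * (Y a - q) - sin a * (X a - p) + \<rho> a * ((sin a)\<^sup>2 + (cos a)\<^sup>2) = 0"
      by algebra
    then show False using Z[OF a] pos[OF a] by simp
  next
    case True
    define \<alpha> where "\<alpha> = Inf I"
    have \<alpha>le: "\<alpha> \<le> x" if "x \<in> I" for x
      unfolding \<alpha>_def using True that by (rule cInf_lower[rotated])
    have \<alpha>I: "\<alpha> \<notin> I"
    proof
      assume "\<alpha> \<in> I"
      then obtain e where "e > 0" "ball \<alpha> e \<subseteq> I" using I(1) open_contains_ball by blast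
      then have "\<alpha> - e/2 \<in> I" by (auto simp: dist_real_def subset_iff)
      then show False using \<alpha>le[of "\<alpha> - e/2"] \<open>e > 0\<close> by simp
    qed
    have down: "x \<in> I" if bx: "b \<in> I" "\<alpha> < x" "x \<le> b" for b x
    proof -
      obtain y where "y \<in> I" "y < x" using bx(2) cInf_lessD[OF I(3)] unfolding \<alpha>_def by blast
      then show ?thesis using ivl[of y b x] bx by simp
    qed
    \<comment> \<open>The height \<open>N \<alpha>\<close>, extended continuously to the missing
      endpoint \<alpha> by the height of the limit point. Measuring from the endpoint itself makes
      any lasting gain contradict the closing of the curve.\<close>
    define M where "M x = (if x = \<alpha> then P \<alpha> else N \<alpha> x)" for x
    have MN: "M x = N \<alpha> x" if "x \<in> I" for x
      using that \<alpha>I by (auto simp: M_def)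
    have derM: "(M has_real_derivative \<rho> x * sin (x - \<alpha>)) (at x)" if "x \<in> I" for x
      using derN[OF that] I(1) that by (rule has_field_derivative_transform_within_open) (simp add: MN)
    have contM: "continuous_on {\<alpha>..b} M" if b: "b \<in> I" for b
      unfolding continuous_on_eq_continuous_within
    proof
      fix x assume x: "x \<in> {\<alpha>..b}"
      show "continuous (at x within {\<alpha>..b}) M"
      proof (cases "x = \<alpha>")
        case False
        then have "x \<in> I" using down[OF b] x by simp
        then show ?thesis using derM DERIV_isCont continuous_at_imp_continuous_at_within by blast
      next
        case True
        show ?thesis
          unfolding True continuous_within_eps_delta
        proof (intro allI impI)
          fix e :: real assume "e > 0"
          then obtain c where c: "c \<in> I" "\<forall>x\<in>I. x \<le> c \<longrightarrow> \<bar>X x - p\<bar> < e/2 \<and> \<bar>Y x - q\<bar> < e/2"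
            using left[of "e/2"] by auto
          have "\<alpha> < c" using \<alpha>le[OF c(1)] \<alpha>I c(1) by (cases "\<alpha> = c") auto
          have "dist (M y) (M \<alpha>) < e" if y: "y \<in> {\<alpha>..b}" "dist y \<alpha> < c - \<alpha>" for y
          proof (cases "y = \<alpha>")
            case False
            then have yI: "y \<in> I" using down[OF b] y by simp
            have "y \<le> c" using y(2) by (simp add: dist_real_def)
            then have "\<bar>N \<alpha> y - P \<alpha>\<bar> < 2 * (e/2)"
              using c(2) yI by (intro NP) auto
            then show ?thesis using MN[OF yI] by (simp add: dist_real_def M_def)
          qed (use \<open>e > 0\<close> in simp)
          then show "\<exists>d>0. \<forall>y\<in>{\<alpha>..b}. dist y \<alpha> < d \<longrightarrow> dist (M y) (M \<alpha>) < e"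
            using \<open>\<alpha> < c\<close> by (intro exI[of _ "c - \<alpha>"]) auto
        qed
      qed
    qed
    have inc: "M x < M y" if "\<alpha> \<le> x" "x < y" "y \<le> \<alpha> + pi" "y \<in> I" for x y
      using that down[OF that(4)]
      by (intro first_half_turn_increasing[of \<alpha> x y M \<rho>] contM derM pos) auto
    have Fmono: "M x + M (x + pi) \<le> M y + M (y + pi)"
      if "\<alpha> \<le> x" "x \<le> y" "y \<le> \<alpha> + pi" "y + pi \<in> I" for x y
      using that down[OF that(4)] pi_ge_two
      by (intro half_turn_sum_mono[of \<alpha> x y M \<rho>] contM derM dec) auto
    \<comment> \<open>A uniform gain near the right end is what has to be shown: there
      \<open>M\<close> tends to \<open>P \<alpha>\<close>, which is also
      \<open>M \<alpha>\<close>.\<close>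
    have "\<exists>b\<in>I. \<exists>\<delta>>0. \<forall>x\<in>I. b \<le> x \<longrightarrow> M \<alpha> + \<delta> \<le> M x"
    proof (cases "\<alpha> + pi \<in> I")
      case False
      \<comment> \<open>The tangent turns by at most half a turn here, and over that range the
        height increases strictly.\<close>
      then have small: "x < \<alpha> + pi" if "x \<in> I" for x
        using down[OF that, of "\<alpha> + pi"] pi_ge_two by fastforce
      obtain b where b: "b \<in> I" using I(3) by blast
      have "\<alpha> < b" using \<alpha>le[OF b] \<alpha>I b by (cases "\<alpha> = b") auto
      then have "M \<alpha> < M b" using small[OF b] b by (intro inc) auto
      moreover have "M b \<le> M x" if "x \<in> I" "b \<le> x" for x
        using inc[of b x] small[OF that(1)] that \<alpha>le[OF b] by (cases "b = x") auto
      ultimately show ?thesis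
        using b by (intro bexI[of _ b] exI[of _ "M b - M \<alpha>"]) auto
    next
      case True
      then obtain r where r: "r > 0" "ball (\<alpha> + pi) r \<subseteq> I" using I(1) open_contains_ball by blast
      \<comment> \<open>Half of \<open>r\<close> keeps \<open>c + pi\<close> inside
        \<open>I\<close>; half of \<open>pi\<close> keeps \<open>c\<close> within the first half
        turn.\<close>
      define c where "c = \<alpha> + min r pi / 2"
      have c: "\<alpha> < c" "c < \<alpha> + pi" "c + pi \<in> I"
      proof -
        show "\<alpha> < c" using r(1) pi_ge_two by (simp add: c_def)
        show "c < \<alpha> + pi" using r(1) pi_ge_two by (simp add: c_def min_def)
        have "c + pi \<in> ball (\<alpha> + pi) r" using r(1) pi_ge_two by (simp add: c_def dist_real_def min_def)
        then show "c + pi \<in> I" using r(2) by blast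
      qed
      \<comment> \<open>The gain of the sum over opposite angles from \<alpha> to \<open>c\<close>.
        If it were not positive, the sum would be constant in between, and opposite radii would
        agree there, against \<open>strict\<close>.\<close>
      define \<delta> where "\<delta> = (M c + M (c + pi)) - (M \<alpha> + M (\<alpha> + pi))"
      have "\<delta> > 0"
      proof (rule ccontr)
        assume "\<not> \<delta> > 0"
        then have const: "M x + M (x + pi) = M \<alpha> + M (\<alpha> + pi)" if "\<alpha> < x" "x < c" for x
          using that c Fmono[of \<alpha> x] Fmono[of x c] down[OF c(3), of "x + pi"] pi_ge_two
          unfolding \<delta>_def by auto
        have in2: "x \<in> I \<and> x + pi \<in> I" if "\<alpha> < x" "x < c" for x
          using that down[OF c(3)] pi_ge_two by auto
        obtain x where x: "\<alpha> < x" "x < c" "\<rho> (x + pi) \<noteq> \<rho> x"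
          using strict[of \<alpha> c] c(1) in2 by auto
        have "((\<lambda>x. M x + M (x + pi)) has_real_derivative (\<rho> x - \<rho> (x + pi)) * sin (x - \<alpha>)) (at x)"
          using in2[OF x(1,2)] by (intro half_turn_sum_deriv derM) auto
        then have "((\<lambda>x. M x + M (x + pi) - (M \<alpha> + M (\<alpha> + pi))) has_real_derivative
            (\<rho> x - \<rho> (x + pi)) * sin (x - \<alpha>)) (at x)"
          using DERIV_diff[OF _ DERIV_const] by fastforce
        then have "(\<rho> x - \<rho> (x + pi)) * sin (x - \<alpha>) = 0"
          by (rule DERIV_of_zero_on_open[of "{\<alpha><..<c}", rotated 3]) (use x const in auto)
        then show False using x c(2) sin_pos_between[of \<alpha> x] by auto
      qed
      \<comment> \<open>The gain persists up to a full turn, since the summand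
        \<open>M (x - pi)\<close> is at most \<open>M (\<alpha> + pi)\<close>. After the full turn,
        \<open>height\<close> applied at \<open>\<alpha> + 2 * pi\<close> excludes a later
        loss.\<close>
      have turn: "M \<alpha> + \<delta> \<le> M x" if "x \<in> I" "c + pi \<le> x" "x \<le> \<alpha> + 2 * pi" for x
      proof -
        have "M c + M (c + pi) \<le> M (x - pi) + M (x - pi + pi)"
          using that c(1) by (intro Fmono) auto
        moreover have "M (x - pi) \<le> M (\<alpha> + pi)"
        proof (cases "x - pi = \<alpha> + pi")
          case False
          then have "M (x - pi) < M (\<alpha> + pi)"
            using that c(1) True by (intro inc) auto
          then show ?thesis by simp
        qed (simp only: order_refl)
        ultimately show ?thesis by (simp add: \<delta>_def)
      qed
      have "M \<alpha> + \<delta> \<le> M x" if x: "x \<in> I" "c + pi \<le> x" for x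
      proof (cases "x \<le> \<alpha> + 2 * pi")
        case False
        have in2: "\<alpha> + 2 * pi \<in> I" using False pi_ge_two by (intro down[OF x(1)]) auto
        have "M (\<alpha> + 2 * pi) \<le> M x"
          using height[OF in2 x(1)] False unfolding N_shift MN[OF in2] MN[OF x(1)] by simp
        moreover have "M \<alpha> + \<delta> \<le> M (\<alpha> + 2 * pi)"
          using c(2) by (intro turn in2) auto
        ultimately show ?thesis by simp
      qed (use turn x in blast)
      then show ?thesis using c(3) \<open>\<delta> > 0\<close> by blast
    qed
    then obtain b \<delta> where b: "b \<in> I" "\<delta> > 0" "\<forall>x\<in>I. b \<le> x \<longrightarrow> M \<alpha> + \<delta> \<le> M x" by blast
    obtain c where c: "c \<in> I" "\<forall>x\<in>I. c \<le> x \<longrightarrow> \<bar>X x - p\<bar> < \<delta>/2 \<and> \<bar>Y x - q\<bar> < \<delta>/2"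
      using right[of "\<delta>/2"] b(2) by auto
    have m: "max b c \<in> I" using b(1) c(1) by (simp add: max_def)
    have "\<bar>N \<alpha> (max b c) - P \<alpha>\<bar> < 2 * (\<delta>/2)"
      using c(2) m by (intro NP) auto
    moreover have "M \<alpha> + \<delta> \<le> M (max b c)" using b(3) m by simp
    ultimately show False using MN[OF m] by (simp add: M_def)
  qed
qed

text \<open>If one of the two strict inequalities never occurred, the curve or its reversed mirror
  image would have a radius that weakly decreases under half turns, and could not close up.\<close>

lemma closed_curve_radius_comparison:
  fixes X Y \<rho> :: "real \<Rightarrow> real"
  assumes I: "open I" "connected I" "I \<noteq> {}"
    and derX: "\<And>x. x \<in> I \<Longrightarrow> (X has_real_derivative \<rho> x * cos x) (at x)"
    and derY: "\<And>x. x \<in> I \<Longrightarrow> (Y has_real_derivative \<rho> x * sin x) (at x)"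
    and pos: "\<And>x. x \<in> I \<Longrightarrow> 0 < \<rho> x"
    and strict: "\<And>a b. a < b \<Longrightarrow> \<forall>x\<in>{a<..<b}. x \<in> I \<and> x + pi \<in> I \<Longrightarrow> \<exists>x\<in>{a<..<b}. \<rho> (x + pi) \<noteq> \<rho> x"
    and left: "\<And>e. e > 0 \<Longrightarrow> \<exists>a\<in>I. \<forall>x\<in>I. x \<le> a \<longrightarrow> \<bar>X x - p\<bar> < e \<and> \<bar>Y x - q\<bar> < e"
    and right: "\<And>e. e > 0 \<Longrightarrow> \<exists>b\<in>I. \<forall>x\<in>I. b \<le> x \<longrightarrow> \<bar>X x - p\<bar> < e \<and> \<bar>Y x - q\<bar> < e"
  shows "\<exists>x. x \<in> I \<and> x + pi \<in> I \<and> \<rho> x < \<rho> (x + pi)"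
    and "\<exists>x. x \<in> I \<and> x + pi \<in> I \<and> \<rho> (x + pi) < \<rho> x"
proof -
  show "\<exists>x. x \<in> I \<and> x + pi \<in> I \<and> \<rho> x < \<rho> (x + pi)"
  proof (rule ccontr)
    assume "\<not> ?thesis"
    then have "\<rho> (x + pi) \<le> \<rho> x" if "x \<in> I" "x + pi \<in> I" for x
      using that by (meson not_le)
    from decreasing_radius_not_closed[OF I derX derY pos this strict left right]
    show False by blast
  qed
  show "\<exists>x. x \<in> I \<and> x + pi \<in> I \<and> \<rho> (x + pi) < \<rho> x"
  proof (rule ccontr)
    assume neg: "\<not> ?thesis"
    \<comment> \<open>Reflecting the curve in the first coordinate axis and reversing it replaces the tangent angle \<open>x\<close> by \<open>pi - x\<close>.\<close>
    define J where "J = (\<lambda>x. pi - x) ` I"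
    have J: "x \<in> J \<longleftrightarrow> pi - x \<in> I" for x
      unfolding J_def by (auto intro: image_eqI[of _ _ "pi - x"])
    have refl: "((\<lambda>x. f (pi - x)) has_real_derivative - l) (at x)"
      if "(f has_real_derivative l) (at (pi - x))" for f l x
    proof -
      have "((\<lambda>x. pi - x) has_real_derivative - 1) (at x)"
        by (rule derivative_eq_intros refl | simp)+
      from DERIV_chain2[OF that this] show ?thesis by simp
    qed
    show False
    proof (rule decreasing_radius_not_closed[of J "\<lambda>x. X (pi - x)" "\<lambda>x. \<rho> (pi - x)" "\<lambda>x. - Y (pi - x)" p "- q"])
      have "J = (\<lambda>x. pi - x) -` I" using J by auto
      then show "open J" using I(1) by (auto intro!: open_vimage continuous_intros)
      show "connected J" unfolding J_def
        by (intro connected_continuous_image I(2) continuous_intros)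
      show "J \<noteq> {}" using I(3) by (simp add: J_def)
      show "((\<lambda>x. X (pi - x)) has_real_derivative \<rho> (pi - x) * cos x) (at x)" if "x \<in> J" for x
        using refl[OF derX] that by (simp add: J)
      show "((\<lambda>x. - Y (pi - x)) has_real_derivative \<rho> (pi - x) * sin x) (at x)" if "x \<in> J" for x
        using DERIV_minus[OF refl[OF derY]] that by (simp add: J)
      show "0 < \<rho> (pi - x)" if "x \<in> J" for x using pos that by (simp add: J)
      show "\<rho> (pi - (x + pi)) \<le> \<rho> (pi - x)" if "x \<in> J" "x + pi \<in> J" for x
        using neg that by (force simp: J not_less)
      show "\<exists>x\<in>{a<..<b}. \<rho> (pi - (x + pi)) \<noteq> \<rho> (pi - x)"
        if "a < b" "\<forall>x\<in>{a<..<b}. x \<in> J \<and> x + pi \<in> J" for a b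
      proof -
        have "\<exists>x\<in>{-b<..<-a}. \<rho> (x + pi) \<noteq> \<rho> x"
        proof (rule strict)
          show "\<forall>x\<in>{-b<..<-a}. x \<in> I \<and> x + pi \<in> I"
          proof
            fix x assume "x \<in> {-b<..<-a}"
            then have "- x \<in> {a<..<b}" by auto
            with that(2) have "- x \<in> J" "- x + pi \<in> J" by blast+
            then show "x \<in> I \<and> x + pi \<in> I" by (simp add: J add.commute)
          qed
        qed (use that in simp)
        then obtain x where "x \<in> {-b<..<-a}" "\<rho> (x + pi) \<noteq> \<rho> x" by blast
        then show ?thesis by (intro bexI[of _ "- x"]) (auto simp: add.commute)
      qed
      show "\<exists>a\<in>J. \<forall>x\<in>J. x \<le> a \<longrightarrow> \<bar>X (pi - x) - p\<bar> < e \<and> \<bar>- Y (pi - x) - - q\<bar> < e" if e: "e > 0" for e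
      proof -
        obtain b where "b \<in> I" "\<forall>x\<in>I. b \<le> x \<longrightarrow> \<bar>X x - p\<bar> < e \<and> \<bar>Y x - q\<bar> < e"
          using right[OF e] by blast
        then show ?thesis
          by (intro bexI[of _ "pi - b"]) (auto simp: J abs_minus_commute)
      qed
      show "\<exists>b\<in>J. \<forall>x\<in>J. b \<le> x \<longrightarrow> \<bar>X (pi - x) - p\<bar> < e \<and> \<bar>- Y (pi - x) - - q\<bar> < e" if e: "e > 0" for e
      proof -
        obtain b where "b \<in> I" "\<forall>x\<in>I. x \<le> b \<longrightarrow> \<bar>X x - p\<bar> < e \<and> \<bar>Y x - q\<bar> < e"
          using left[OF e] by blast
        then show ?thesis
          by (intro bexI[of _ "pi - b"]) (auto simp: J abs_minus_commute)
      qed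
    qed
  qed
qed

section \<open>Loops parameterized by the tangent angle\<close>

text \<open>The interiors of the sets where \<open>G\<close> is nonnegative and nonpositive cover
  \<open>D\<close> by the local signs. They are disjoint, as \<open>G\<close> would vanish on a ball
  in their intersection, so connectedness leaves only one of them. The function \<open>G\<close> may
  have zeros and is not assumed continuous, so the intermediate value theorem does not
  apply.\<close>

lemma connected_one_signed:
  fixes G :: "real \<Rightarrow> real"
  assumes "connected D"
    and nonzero: "\<And>s e. e > 0 \<Longrightarrow> ball s e \<subseteq> D \<Longrightarrow> \<exists>y\<in>ball s e. G y \<noteq> 0"
    and signed: "\<And>s. s \<in> D \<Longrightarrow> \<exists>e>0. ball s e \<subseteq> D \<and> ((\<forall>y\<in>ball s e. 0 \<le> G y) \<or> (\<forall>y\<in>ball s e. G y \<le> 0))"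
  shows "(\<forall>s\<in>D. 0 \<le> G s) \<or> (\<forall>s\<in>D. G s \<le> 0)"
proof (rule ccontr)
  assume neg: "\<not> ?thesis"
  define A where "A = interior {s \<in> D. 0 \<le> G s}"
  define B where "B = interior {s \<in> D. G s \<le> 0}"
  have AB: "s \<in> A \<or> s \<in> B" if s: "s \<in> D" for s
  proof -
    obtain e where e: "e > 0" "ball s e \<subseteq> D"
      "(\<forall>y\<in>ball s e. 0 \<le> G y) \<or> (\<forall>y\<in>ball s e. G y \<le> 0)"
      using signed[OF s] by blast
    then have "ball s e \<subseteq> {s \<in> D. 0 \<le> G s} \<or> ball s e \<subseteq> {s \<in> D. G s \<le> 0}" by blast
    then show ?thesis
      unfolding A_def B_def using e(1) by (meson centre_in_ball interior_maximal open_ball subsetD)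
  qed
  have "A \<inter> B = {}"
  proof (rule ccontr)
    assume "A \<inter> B \<noteq> {}"
    then obtain s where "s \<in> A \<inter> B" by blast
    moreover have "open (A \<inter> B)" by (simp add: A_def B_def open_Int)
    ultimately obtain e where e: "e > 0" "ball s e \<subseteq> A \<inter> B" by (meson open_contains_ball)
    have sub: "A \<subseteq> {s \<in> D. 0 \<le> G s}" "B \<subseteq> {s \<in> D. G s \<le> 0}"
      unfolding A_def B_def by (rule interior_subset)+
    then have "ball s e \<subseteq> D" using e(2) by blast
    then obtain y where "y \<in> ball s e" "G y \<noteq> 0" using nonzero[OF e(1)] by blast
    then show False using e(2) sub by force
  qed
  moreover have "open A" "open B" by (simp_all add: A_def B_def)
  moreover have "D \<subseteq> A \<union> B" using AB by blast
  ultimately have "A \<inter> D = {} \<or> B \<inter> D = {}"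
    using assms(1) connectedD[of D A B] by blast
  then have "D \<subseteq> A \<or> D \<subseteq> B" using AB by blast
  then show False using neg unfolding A_def B_def using interior_subset by blast
qed

text \<open>The quotient is the cosine of the polar angle of \<open>(P, Q)\<close>, and the equation
  in the hypotheses says that the angular velocity of this vector is zero at
  \<open>s\<close>.\<close>

lemma DERIV_normalized_component:
  fixes P Q :: "real \<Rightarrow> real"
  assumes "(P has_real_derivative P') (at s)" "(Q has_real_derivative Q') (at s)"
    and eq: "Q s * P' = P s * Q'" and pos: "0 < (P s)\<^sup>2 + (Q s)\<^sup>2"
  shows "((\<lambda>s. P s / sqrt ((P s)\<^sup>2 + (Q s)\<^sup>2)) has_real_derivative 0) (at s)"
proof -
  define R where "R = sqrt ((P s)\<^sup>2 + (Q s)\<^sup>2)"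
  have R: "R > 0" "R * R = (P s)\<^sup>2 + (Q s)\<^sup>2"
    using pos by (simp_all add: R_def)
  have dq: "((\<lambda>s. (P s)\<^sup>2 + (Q s)\<^sup>2) has_real_derivative 2 * (P s * P' + Q s * Q')) (at s)"
    by (rule derivative_eq_intros assms(1,2) refl | simp add: algebra_simps)+
  have "inverse R / 2 * (2 * (P s * P' + Q s * Q')) = (P s * P' + Q s * Q') / R"
    using R(1) by (simp add: field_simps)
  from DERIV_cong[OF DERIV_chain2[OF DERIV_real_sqrt[OF pos] dq] this[unfolded R_def]]
  have dR: "((\<lambda>s. sqrt ((P s)\<^sup>2 + (Q s)\<^sup>2)) has_real_derivative (P s * P' + Q s * Q') / R) (at s)"
    unfolding R_def .
  have "sqrt ((P s)\<^sup>2 + (Q s)\<^sup>2) \<noteq> 0"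
    using R(1) by (simp only: R_def)
  from DERIV_divide[OF assms(1) dR this]
  have "((\<lambda>s. P s / sqrt ((P s)\<^sup>2 + (Q s)\<^sup>2)) has_real_derivative
      (P' * R - P s * ((P s * P' + Q s * Q') / R)) / (R * R)) (at s)"
    unfolding R_def .
  moreover have "P' * R - P s * ((P s * P' + Q s * Q') / R) = 0"
  proof -
    have "P' * (R * R) = P s * (P s * P' + Q s * Q')"
      unfolding R(2) using eq by algebra
    then show ?thesis using R(1) by (simp add: field_simps)
  qed
  ultimately show ?thesis by simp
qed

text \<open>The sign of \<open>r\<close> is that of the curvature, so that the radius of curvature \<open>r / \<omega>\<close> is
  positive in both cases.\<close>

lemma tangent_angle:
  fixes \<gamma> :: "real \<Rightarrow> real^2"
  assumes loop: "is_loop \<gamma> s1 s2"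
  obtains \<theta> \<omega> r where
    "\<forall>s\<in>{s1<..<s2}. (\<theta> has_real_derivative \<omega> s) (at s)"
    "smooth_on \<omega> {s1<..<s2}"
    "(\<forall>s\<in>{s1<..<s2}. \<omega> s > 0) \<or> (\<forall>s\<in>{s1<..<s2}. \<omega> s < 0)"
    "\<forall>s\<in>{s1<..<s2}. (\<gamma> has_vector_derivative r s *\<^sub>R dir (\<theta> s)) (at s)"
    "\<forall>s\<in>{s1<..<s2}. 0 < r s / \<omega> s"
proof -
  define S where "S = {s1<..<s2}"
  have openS: "open S" and s12: "s1 < s2" and smooth: "smooth_on \<gamma> S"
    and reg: "\<And>s. s \<in> S \<Longrightarrow> velocity \<gamma> s \<noteq> 0" and curv: "\<And>s. s \<in> S \<Longrightarrow> curvature \<gamma> s \<noteq> 0"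
    using loop unfolding is_loop_def S_def by auto
  define v where "v = velocity \<gamma>"
  define w where "w = velocity v"
  have smv: "smooth_on v S" and \<gamma>v: "\<And>s. s \<in> S \<Longrightarrow> (\<gamma> has_vector_derivative v s) (at s)"
    unfolding v_def using smooth_on_velocity[OF openS smooth] by blast+
  have smw: "smooth_on w S" and vw: "\<And>s. s \<in> S \<Longrightarrow> (v has_vector_derivative w s) (at s)"
    unfolding w_def using smooth_on_velocity[OF openS smv] by blast+
  have dv: "((\<lambda>s. v s $ i) has_real_derivative w s $ i) (at s)" if "s \<in> S" for s i
    using has_vector_derivative_vec_nth[OF vw[OF that]]
    by (simp add: has_real_derivative_iff_has_vector_derivative)
  define q where "q s = v s $ 1 * v s $ 1 + v s $ 2 * v s $ 2" for s
  have q: "q s > 0" if "s \<in> S" for s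
  proof -
    have "v s $ 1 \<noteq> 0 \<or> v s $ 2 \<noteq> 0"
      using reg[OF that] by (simp add: v_def vec_eq_iff forall_2)
    then show ?thesis by (auto simp: q_def simp flip: power2_eq_square intro: add_pos_nonneg add_nonneg_pos)
  qed
  \<comment> \<open>Curvature times speed, that is, the angular velocity of the tangent.\<close>
  define \<omega> where "\<omega> s = (v s $ 1 * w s $ 2 - v s $ 2 * w s $ 1) * inverse (q s)" for s
  have Cn: "Cn_on n \<omega> S" for n
  proof -
    have V: "Cn_on n (\<lambda>s. v s $ i) S" and W: "Cn_on n (\<lambda>s. w s $ i) S" for i
      using smv smw Cn_on_vec_nth unfolding smooth_on_iff by blast+
    have "Cn_on n q S"
      unfolding q_def by (rule Cn_on_add[OF Cn_on_mult[OF V V] Cn_on_mult[OF V V]])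
    then have "Cn_on n (\<lambda>s. inverse (q s)) S"
      by (rule Cn_on_inverse[rotated]) (use q in force)
    then show ?thesis
      unfolding \<omega>_def by (rule Cn_on_mult[OF Cn_on_diff[OF Cn_on_mult[OF V W] Cn_on_mult[OF V W]]])
  qed
  have \<omega>0: "\<omega> s \<noteq> 0" if "s \<in> S" for s
    using curv[OF that] q[OF that] unfolding curvature_def \<omega>_def v_def w_def by auto
  have \<omega>c: "continuous_on S \<omega>" using Cn[of 0] by simp
  have isC: "isCont \<omega> s" if "s \<in> S" for s
    using \<omega>c that by (simp add: continuous_on_eq_continuous_at[OF openS])
  have sgn: "(\<forall>s\<in>S. \<omega> s > 0) \<or> (\<forall>s\<in>S. \<omega> s < 0)"
    by (rule connected_nonzero_constant_sign[OF _ \<omega>c \<omega>0]) (simp_all add: S_def)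
  have "\<exists>F. \<forall>x. ereal s1 < ereal x \<longrightarrow> ereal x < ereal s2 \<longrightarrow> (F has_vector_derivative \<omega> x) (at x)"
    using s12 isC by (intro einterval_antiderivative) (auto simp: S_def)
  then obtain F where F: "\<And>s. s \<in> S \<Longrightarrow> (F has_real_derivative \<omega> s) (at s)"
    unfolding S_def has_real_derivative_iff_has_vector_derivative by auto
  \<comment> \<open>\<open>P\<close> and \<open>Q\<close> are the components of the velocity in the
    frame rotated by \<open>F\<close>. Frame and velocity turn at the same rate, so the direction of
    \<open>(P, Q)\<close> is constant; \<open>key\<close> expresses that its angular velocity
    vanishes.\<close>
  define P where "P s = v s $ 1 * cos (F s) + v s $ 2 * sin (F s)" for s
  define Q where "Q s = v s $ 2 * cos (F s) - v s $ 1 * sin (F s)" for s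
  have sc: "(sin (F s))\<^sup>2 + (cos (F s))\<^sup>2 = 1" for s by simp
  have PQ: "(P s)\<^sup>2 + (Q s)\<^sup>2 = q s" for s
    unfolding P_def Q_def q_def using sc[of s] by algebra
  have dP: "(P has_real_derivative (w s $ 1 * cos (F s) + w s $ 2 * sin (F s) + \<omega> s * Q s)) (at s)"
    and dQ: "(Q has_real_derivative (w s $ 2 * cos (F s) - w s $ 1 * sin (F s) - \<omega> s * P s)) (at s)"
    if "s \<in> S" for s
    unfolding P_def[abs_def] Q_def[abs_def]
    by (rule derivative_eq_intros dv[OF that] F[OF that] refl | simp add: algebra_simps)+
  have key: "Q s * (w s $ 1 * cos (F s) + w s $ 2 * sin (F s) + \<omega> s * Q s)
      = P s * (w s $ 2 * cos (F s) - w s $ 1 * sin (F s) - \<omega> s * P s)" if "s \<in> S" for s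
  proof -
    have "\<omega> s * q s = v s $ 1 * w s $ 2 - v s $ 2 * w s $ 1"
      using q[OF that] by (simp add: \<omega>_def)
    then have "\<omega> s * ((P s)\<^sup>2 + (Q s)\<^sup>2) = v s $ 1 * w s $ 2 - v s $ 2 * w s $ 1"
      by (simp add: PQ)
    moreover have "P s * (w s $ 2 * cos (F s) - w s $ 1 * sin (F s)) - Q s * (w s $ 1 * cos (F s) + w s $ 2 * sin (F s))
        = v s $ 1 * w s $ 2 - v s $ 2 * w s $ 1"
      unfolding P_def Q_def using sc[of s] by algebra
    ultimately show ?thesis by algebra
  qed
  define m where "m = (s1 + s2) / 2"
  have m: "m \<in> S" using s12 by (simp add: m_def S_def)
  have const: "P s / sqrt (q s) = P m / sqrt (q m)" "Q s / sqrt (q s) = Q m / sqrt (q m)" if "s \<in> S" for s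
  proof -
    have "((\<lambda>s. P s / sqrt (q s)) has_real_derivative 0) (at x)" if "x \<in> S" for x
      using DERIV_normalized_component[OF dP[OF that] dQ[OF that] key[OF that]] q[OF that]
      by (simp add: PQ)
    then show "P s / sqrt (q s) = P m / sqrt (q m)"
      using that m s12 unfolding S_def by (intro DERIV_isconst3[of s1 s2]) auto
    have "((\<lambda>s. Q s / sqrt (q s)) has_real_derivative 0) (at x)" if "x \<in> S" for x
      using DERIV_normalized_component[OF dQ[OF that] dP[OF that] key[OF that, symmetric]] q[OF that]
      by (simp add: PQ add.commute)
    then show "Q s / sqrt (q s) = Q m / sqrt (q m)"
      using that m s12 unfolding S_def by (intro DERIV_isconst3[of s1 s2]) auto
  qed
  \<comment> \<open>The constant unit vector supplies the angle \<phi>, which fixes the additive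
    constant left open in the antiderivative \<open>F\<close>.\<close>
  have "(P m / sqrt (q m))\<^sup>2 + (Q m / sqrt (q m))\<^sup>2 = 1"
    using q[OF m] PQ[of m] by (simp add: power_divide flip: add_divide_distrib)
  then obtain \<phi> where \<phi>: "P m / sqrt (q m) = cos \<phi>" "Q m / sqrt (q m) = sin \<phi>"
    using sincos_total_2pi by metis
  have vdir: "v s = sqrt (q s) *\<^sub>R dir (F s + \<phi>)" if "s \<in> S" for s
  proof -
    have "P s = sqrt (q s) * cos \<phi>" "Q s = sqrt (q s) * sin \<phi>"
      using const[OF that] q[OF that] unfolding \<phi> by (simp_all add: field_simps)
    moreover have "v s $ 1 = P s * cos (F s) - Q s * sin (F s)" "v s $ 2 = P s * sin (F s) + Q s * cos (F s)"
      unfolding P_def Q_def using sc[of s] by algebra+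
    ultimately show ?thesis
      by (simp add: vec_eq_iff forall_2 cos_add sin_add algebra_simps)
  qed
  show thesis
    using sgn
  proof
    assume pos: "\<forall>s\<in>S. \<omega> s > 0"
    show thesis
    proof (rule that[of "\<lambda>s. F s + \<phi>" \<omega> "\<lambda>s. sqrt (q s)"])
      show "\<forall>s\<in>{s1<..<s2}. ((\<lambda>s. F s + \<phi>) has_real_derivative \<omega> s) (at s)"
        using DERIV_add[OF F DERIV_const, of _ \<phi>] by (simp add: S_def)
      show "smooth_on \<omega> {s1<..<s2}" using Cn unfolding smooth_on_iff S_def by blast
      show "(\<forall>s\<in>{s1<..<s2}. \<omega> s > 0) \<or> (\<forall>s\<in>{s1<..<s2}. \<omega> s < 0)" using sgn by (simp add: S_def)
      show "\<forall>s\<in>{s1<..<s2}. (\<gamma> has_vector_derivative sqrt (q s) *\<^sub>R dir (F s + \<phi>)) (at s)"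
        using \<gamma>v vdir by (simp add: S_def)
      show "\<forall>s\<in>{s1<..<s2}. 0 < sqrt (q s) / \<omega> s"
        using pos q by (simp add: S_def)
    qed
  next
    assume neg: "\<forall>s\<in>S. \<omega> s < 0"
    show thesis
    \<comment> \<open>For negative curvature an extra half turn reverses \<open>dir\<close>, so that
      \<open>r\<close> is negative together with \<omega>.\<close>
    proof (rule that[of "\<lambda>s. F s + \<phi> + pi" \<omega> "\<lambda>s. - sqrt (q s)"])
      show "\<forall>s\<in>{s1<..<s2}. ((\<lambda>s. F s + \<phi> + pi) has_real_derivative \<omega> s) (at s)"
        using DERIV_add[OF F DERIV_const, of _ "\<phi> + pi"] by (simp add: S_def add.assoc)
      show "smooth_on \<omega> {s1<..<s2}" using Cn unfolding smooth_on_iff S_def by blast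
      show "(\<forall>s\<in>{s1<..<s2}. \<omega> s > 0) \<or> (\<forall>s\<in>{s1<..<s2}. \<omega> s < 0)" using sgn by (simp add: S_def)
      show "\<forall>s\<in>{s1<..<s2}. (\<gamma> has_vector_derivative (- sqrt (q s)) *\<^sub>R dir (F s + \<phi> + pi)) (at s)"
        using \<gamma>v vdir by (simp add: S_def)
      show "\<forall>s\<in>{s1<..<s2}. 0 < - sqrt (q s) / \<omega> s"
        using neg q by (simp add: S_def divide_pos_neg)
    qed
  qed
qed

lemma affine_parallel_lines:
  assumes "u = k *\<^sub>R v" "k \<noteq> 0"
  shows "affine_parallel {a + c *\<^sub>R u | c. True} {b + c *\<^sub>R v | c. True}"
  unfolding affine_parallel_def
proof (intro exI set_eqI iffI)
  fix x assume "x \<in> {b + c *\<^sub>R v | c. True}"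
  then obtain c where "x = b + c *\<^sub>R v" by blast
  then have "x = (b - a) + (a + (c / k) *\<^sub>R u)" using assms by simp
  then show "x \<in> (\<lambda>x. (b - a) + x) ` {a + c *\<^sub>R u | c. True}" by blast
next
  fix x assume "x \<in> (\<lambda>x. (b - a) + x) ` {a + c *\<^sub>R u | c. True}"
  then obtain c where "x = (b - a) + (a + c *\<^sub>R u)" by blast
  then have "x = b + (c * k) *\<^sub>R v" using assms by simp
  then show "x \<in> {b + c *\<^sub>R v | c. True}" by blast
qed

theorem theorem3p2:
  fixes \<gamma> :: "real \<Rightarrow> real^2" and s1 s2 :: real
  assumes "is_loop \<gamma> s1 s2"
  shows "\<exists>p \<in> wigner_caustic \<gamma> {s1<..<s2}. equidistant_singular_point (1/2) \<gamma> {s1<..<s2} p"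
proof (rule ccontr)
  assume none: "\<not> ?thesis"

  \<comment> \<open>The loop in terms of its tangent angle\<close>
  define S where "S = {s1<..<s2}"
  have s12: "s1 < s2" and inj\<gamma>: "inj_on \<gamma> S"
    using assms unfolding is_loop_def S_def by blast+
  obtain p where p1: "(\<gamma> \<longlongrightarrow> p) (at_right s1)" and p2: "(\<gamma> \<longlongrightarrow> p) (at_left s2)"
    using assms unfolding is_loop_def by blast
  obtain \<theta> \<omega> r where d\<theta>': "\<forall>s\<in>S. (\<theta> has_real_derivative \<omega> s) (at s)"
    and sm\<omega>: "smooth_on \<omega> S"
    and sgn: "(\<forall>s\<in>S. \<omega> s > 0) \<or> (\<forall>s\<in>S. \<omega> s < 0)"
    and d\<gamma>': "\<forall>s\<in>S. (\<gamma> has_vector_derivative r s *\<^sub>R dir (\<theta> s)) (at s)"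
    and r\<omega>': "\<forall>s\<in>S. 0 < r s / \<omega> s"
    unfolding S_def by (rule tangent_angle[OF assms])
  note d\<theta> = d\<theta>'[rule_format] and d\<gamma> = d\<gamma>'[rule_format] and r\<omega> = r\<omega>'[rule_format]
  have \<omega>0: "\<omega> s \<noteq> 0" and r0: "r s \<noteq> 0" if "s \<in> S" for s
    using r\<omega>[OF that] by auto
  have SI: "x \<in> S" if "a \<in> S" "b \<in> S" "a \<le> x" "x \<le> b" for a b x
    using that by (auto simp: S_def)
  have openS: "open S" by (simp add: S_def)
  have cont\<theta>: "continuous_on S \<theta>"
    using d\<theta> DERIV_isCont by (blast intro: continuous_at_imp_continuous_on)
  have mono: "(\<forall>a\<in>S. \<forall>b\<in>S. a < b \<longrightarrow> \<theta> a < \<theta> b) \<or> (\<forall>a\<in>S. \<forall>b\<in>S. a < b \<longrightarrow> \<theta> b < \<theta> a)"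
    using sgn
  proof
    assume pos: "\<forall>s\<in>S. \<omega> s > 0"
    have "\<theta> a < \<theta> b" if ab: "a \<in> S" "b \<in> S" "a < b" for a b
    proof (rule DERIV_pos_imp_increasing[OF ab(3)])
      fix x assume "a \<le> x" "x \<le> b"
      then have "x \<in> S" using SI ab by blast
      then show "\<exists>y. (\<theta> has_real_derivative y) (at x) \<and> 0 < y" using d\<theta> pos by blast
    qed
    then show ?thesis by blast
  next
    assume neg: "\<forall>s\<in>S. \<omega> s < 0"
    have "\<theta> b < \<theta> a" if ab: "a \<in> S" "b \<in> S" "a < b" for a b
    proof (rule DERIV_neg_imp_decreasing[OF ab(3)])
      fix x assume "a \<le> x" "x \<le> b"
      then have "x \<in> S" using SI ab by blast
      then show "\<exists>y. (\<theta> has_real_derivative y) (at x) \<and> y < 0" using d\<theta> neg by blast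
    qed
    then show ?thesis by blast
  qed
  have inj\<theta>: "inj_on \<theta> S"
    by (rule inj_onI) (metis mono less_irrefl linorder_less_linear)
  define I where "I = \<theta> ` S"
  define \<sigma> where "\<sigma> = the_inv_into S \<theta>"
  have \<sigma>S: "\<sigma> x \<in> S" and \<theta>\<sigma>: "\<theta> (\<sigma> x) = x" if "x \<in> I" for x
    using that inj\<theta> unfolding I_def \<sigma>_def
    by (auto intro: the_inv_into_into f_the_inv_into_f)
  have \<sigma>\<theta>: "\<sigma> (\<theta> s) = s" if "s \<in> S" for s
    using that inj\<theta> unfolding \<sigma>_def by (rule the_inv_into_f_f[rotated])
  have \<theta>I: "\<theta> s \<in> I" if "s \<in> S" for s using that by (simp add: I_def)
  have openI: "open I"
    unfolding I_def by (rule invariance_of_domain[OF cont\<theta> openS inj\<theta>])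
  have connI: "connected I"
    unfolding I_def by (rule connected_continuous_image[OF cont\<theta>]) (simp add: S_def)
  have I0: "I \<noteq> {}" using s12 dense by (force simp: I_def S_def)
  have II: "x \<in> I" if "a \<in> I" "b \<in> I" "a \<le> x" "x \<le> b" for a b x
    using connI that unfolding is_interval_connected_1[symmetric] is_interval_1 by blast
  have d\<sigma>: "(\<sigma> has_real_derivative inverse (\<omega> (\<sigma> x))) (at x)" if "x \<in> I" for x
  proof -
    have "(\<sigma> has_derivative (*) (inverse (\<omega> (\<sigma> x)))) (at (\<theta> (\<sigma> x)))"
      by (rule has_derivative_inverse_strong[OF openS \<sigma>S[OF that] cont\<theta> \<sigma>\<theta>])
        (use d\<theta>[OF \<sigma>S[OF that]] \<omega>0[OF \<sigma>S[OF that]] in \<open>auto simp: has_field_derivative_def fun_eq_iff\<close>)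
    then show ?thesis using \<theta>\<sigma>[OF that] by (simp add: has_field_derivative_def)
  qed
  define \<rho> where "\<rho> x = r (\<sigma> x) / \<omega> (\<sigma> x)" for x
  have \<rho>\<theta>: "\<rho> (\<theta> s) = r s / \<omega> s" if "s \<in> S" for s
    using \<sigma>\<theta>[OF that] by (simp add: \<rho>_def)

  \<comment> \<open>The branch of the Wigner caustic formed by pairs half a turn apart\<close>
  define D where "D = {s \<in> S. \<theta> s + pi \<in> I}"
  have DS: "D \<subseteq> S" by (auto simp: D_def)
  \<comment> \<open>The parameter whose tangent angle is half a turn larger; \<open>D\<close>
    collects the parameters for which it exists.\<close>
  define t where "t s = \<sigma> (\<theta> s + pi)" for s
  have tS: "t s \<in> S" and \<theta>t: "\<theta> (t s) = \<theta> s + pi" if "s \<in> D" for s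
    using that \<sigma>S \<theta>\<sigma> by (auto simp: D_def t_def)
  have dt: "(t has_real_derivative \<omega> s * inverse (\<omega> (t s))) (at s)" if "s \<in> D" for s
  proof -
    have 1: "((\<lambda>s. \<theta> s + pi) has_real_derivative \<omega> s) (at s)"
      using DERIV_add[OF d\<theta> DERIV_const, of s pi] that DS by auto
    have "(\<sigma> has_real_derivative inverse (\<omega> (\<sigma> (\<theta> s + pi)))) (at (\<theta> s + pi))"
      using that by (intro d\<sigma>) (simp add: D_def)
    from DERIV_chain2[OF this 1] show ?thesis
      unfolding t_def by (simp only: mult.commute)
  qed
  have smt: "smooth_on t D"
  proof (rule smooth_on_separable_ode[where \<psi> = "\<lambda>s. inverse (\<omega> s)", OF dt])
    show "smooth_on \<omega> D" using sm\<omega> DS by (rule smooth_on_subset)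
    show "smooth_on (\<lambda>s. inverse (\<omega> s)) S"
      using sm\<omega> Cn_on_inverse[of S \<omega>] \<omega>0 unfolding smooth_on_iff by blast
    show "t ` D \<subseteq> S" using tS by blast
  qed
  have pair: "parallel_pair \<gamma> S (\<gamma> s) (\<gamma> (t s))" if s: "s \<in> D" for s
  proof -
    have sS: "s \<in> S" using s DS by blast
    have "t s \<noteq> s" using \<theta>t[OF s] pi_gt_zero by force
    then have ne: "\<gamma> s \<noteq> \<gamma> (t s)" using inj\<gamma> sS tS[OF s] unfolding inj_on_def by metis
    have "velocity \<gamma> s = r s *\<^sub>R dir (\<theta> s)" "velocity \<gamma> (t s) = - (r (t s) *\<^sub>R dir (\<theta> s))"
      using vector_derivative_at[OF d\<gamma>[OF sS]] vector_derivative_at[OF d\<gamma>[OF tS[OF s]]] \<theta>t[OF s]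
      by simp_all
    then have "velocity \<gamma> s = (- r s / r (t s)) *\<^sub>R velocity \<gamma> (t s)" "- r s / r (t s) \<noteq> 0"
      using r0[OF tS[OF s]] r0[OF sS] by simp_all
    then have "affine_parallel (tangent_line \<gamma> s) (tangent_line \<gamma> (t s))"
      unfolding tangent_line_def by (rule affine_parallel_lines)
    then show ?thesis unfolding parallel_pair_def using ne sS tS[OF s] by blast
  qed
  define f where "f s = (1/2) *\<^sub>R \<gamma> s + (1 - 1/2) *\<^sub>R \<gamma> (t s)" for s
  \<comment> \<open>The two points have opposite directions \<open>dir\<close>, so their
    contributions to the derivative of \<open>f\<close> subtract: half the angular velocity times
    the difference of the radii remains.\<close>
  define G where "G s = (1/2) * \<omega> s * (\<rho> (\<theta> s) - \<rho> (\<theta> s + pi))" for s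
  have df: "(f has_vector_derivative G s *\<^sub>R dir (\<theta> s)) (at s)" if s: "s \<in> D" for s
  proof -
    have sS: "s \<in> S" using s DS by blast
    have "(t has_vector_derivative \<omega> s * inverse (\<omega> (t s))) (at s)"
      using dt[OF s] by (simp add: has_real_derivative_iff_has_vector_derivative)
    from vector_diff_chain_at[OF this d\<gamma>[OF tS[OF s]]]
    have "((\<lambda>s. \<gamma> (t s)) has_vector_derivative
        (\<omega> s * inverse (\<omega> (t s))) *\<^sub>R (r (t s) *\<^sub>R dir (\<theta> s + pi))) (at s)"
      by (simp add: o_def \<theta>t[OF s])
    then have "(f has_vector_derivative (1/2) *\<^sub>R (r s *\<^sub>R dir (\<theta> s)) +
        (1 - 1/2) *\<^sub>R ((\<omega> s * inverse (\<omega> (t s))) *\<^sub>R (r (t s) *\<^sub>R dir (\<theta> s + pi)))) (at s)"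
      unfolding f_def using d\<gamma>[OF sS]
      by (intro has_vector_derivative_add bounded_linear.has_vector_derivative[OF bounded_linear_scaleR_right])
    moreover have "G s = (1/2) * r s - (1/2) * (\<omega> s * inverse (\<omega> (t s)) * r (t s))"
      unfolding G_def \<rho>\<theta>[OF sS] \<theta>t[OF s, symmetric] \<rho>\<theta>[OF tS[OF s]]
      using \<omega>0[OF sS] by (simp add: field_simps)
    ultimately show ?thesis by (simp add: scaleR_left_diff_distrib)
  qed

  \<comment> \<open>Consequences of the absence of singular points\<close>
  have nonsing: "\<not> singular_at f {c<..<d} s0" if s0: "s0 \<in> {c<..<d}" and sub: "{c<..<d} \<subseteq> D" for c d s0
  proof
    assume sing: "singular_at f {c<..<d} s0"
    have "s0 \<in> D" using s0 sub by blast
    have "parallel_branch \<gamma> S c d t"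
      unfolding parallel_branch_def
      using sub DS tS pair smooth_on_subset[OF smt sub] by blast
    then have "equidistant_singular_point (1/2) \<gamma> S (f s0)"
      unfolding equidistant_singular_point_def using s0 sing unfolding f_def by blast
    moreover have "f s0 \<in> wigner_caustic \<gamma> S"
      unfolding wigner_caustic_def equidistant_def f_def using pair[OF \<open>s0 \<in> D\<close>] by blast
    ultimately show False using none unfolding S_def by blast
  qed
  \<comment> \<open>Otherwise the branch would be constant on the interval and singular at its
    midpoint.\<close>
  have nonzero: "\<exists>s\<in>{c<..<d}. G s \<noteq> 0" if cd: "c < d" and sub: "{c<..<d} \<subseteq> D" for c d
  proof (rule ccontr)
    assume "\<not> ?thesis"
    then have "(f has_vector_derivative 0) (at s)" if "s \<in> {c<..<d}" for s
      using df[of s] that subsetD[OF sub that] by simp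
    then have "(f has_vector_derivative 0) (at s within {c<..<d})" if "s \<in> {c<..<d}" for s
      using that has_vector_derivative_at_within by blast
    then obtain q where q: "\<And>s. s \<in> {c<..<d} \<Longrightarrow> f s = q"
      using has_vector_derivative_zero_constant[of "{c<..<d}" f] by auto
    have "singular_at f {c<..<d} ((c + d) / 2)"
      using cd by (intro singular_at_const[OF _ _ q]) auto
    then show False using nonsing[of "(c + d) / 2" c d] cd sub by simp
  qed
  have openD: "open D"
  proof -
    have "D = S \<inter> (\<lambda>s. \<theta> s + pi) -` I" by (auto simp: D_def)
    moreover have "continuous_on S (\<lambda>s. \<theta> s + pi)"
      by (intro continuous_intros cont\<theta>)
    ultimately show ?thesis using continuous_open_preimage[OF _ openS openI] by metis
  qed
  have connD: "connected D"
    unfolding is_interval_connected_1[symmetric] is_interval_1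
  proof (intro allI ballI impI)
    fix a b x assume "a \<in> D" "b \<in> D" "a \<le> x \<and> x \<le> b"
    then have ab: "a \<in> D" "b \<in> D" "a \<le> x" "x \<le> b" by auto
    have S3: "a \<in> S" "b \<in> S" "x \<in> S" using DS SI ab by blast+
    then have "\<theta> a \<le> \<theta> x \<and> \<theta> x \<le> \<theta> b \<or> \<theta> b \<le> \<theta> x \<and> \<theta> x \<le> \<theta> a"
      using mono ab(3,4) by (metis less_eq_real_def)
    then have "\<theta> x + pi \<in> I"
      using ab(1,2) II[of "\<theta> a + pi" "\<theta> b + pi" "\<theta> x + pi"] II[of "\<theta> b + pi" "\<theta> a + pi" "\<theta> x + pi"]
      by (auto simp: D_def)
    then show "x \<in> D" using S3 by (simp add: D_def)
  qed
  \<comment> \<open>The local sign near each point extends to all of \<open>D\<close>, because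
    \<open>D\<close> is connected and \<open>G\<close> vanishes on no interval.\<close>
  have Gsgn: "(\<forall>s\<in>D. 0 \<le> G s) \<or> (\<forall>s\<in>D. G s \<le> 0)"
  proof (rule connected_one_signed[OF connD])
    show "\<exists>y\<in>ball s e. G y \<noteq> 0" if "e > 0" "ball s e \<subseteq> D" for s e
      using nonzero[of "s - e" "s + e"] that by (simp add: ball_eq_greaterThanLessThan)
    fix s0 assume "s0 \<in> D"
    then obtain e where e: "e > 0" "ball s0 e \<subseteq> D" using openD open_contains_ball by blast
    define c where "c = s0 - e"
    define d where "d = s0 + e"
    have cd: "ball s0 e = {c<..<d}" by (simp add: c_def d_def ball_eq_greaterThanLessThan)
    have s0cd: "s0 \<in> {c<..<d}" using e(1) by (simp add: c_def d_def)
    have sub: "{c<..<d} \<subseteq> D" using e(2) cd by simp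
    obtain \<delta> where "\<delta> > 0" "ball s0 \<delta> \<subseteq> {c<..<d}"
      "(\<forall>s\<in>ball s0 \<delta>. 0 \<le> G s) \<or> (\<forall>s\<in>ball s0 \<delta>. G s \<le> 0)"
    proof (rule locally_one_signed[OF s0cd, of f G \<theta>])
      show "(f has_vector_derivative G s *\<^sub>R dir (\<theta> s)) (at s)" if "s \<in> {c<..<d}" for s
        using df sub that by blast
      show "continuous_on {c<..<d} \<theta>" using cont\<theta> sub DS by (meson continuous_on_subset order_trans)
      show "inj_on \<theta> {c<..<d}" using inj\<theta> sub DS by (meson inj_on_subset order_trans)
      show "\<exists>s\<in>{a<..<b}. G s \<noteq> 0" if "c \<le> a" "a < b" "b \<le> d" for a b
      proof (rule nonzero[OF that(2)])
        have "{a<..<b} \<subseteq> {c<..<d}" using that by auto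
        then show "{a<..<b} \<subseteq> D" using sub by blast
      qed
      show "\<not> singular_at f {c<..<d} s0" by (rule nonsing[OF s0cd sub])
    qed blast
    then show "\<exists>e>0. ball s0 e \<subseteq> D \<and> ((\<forall>y\<in>ball s0 e. 0 \<le> G y) \<or> (\<forall>y\<in>ball s0 e. G y \<le> 0))"
      using sub by blast
  qed

  \<comment> \<open>The closing condition and the radius as functions of the tangent angle\<close>
  have endL: "\<exists>a\<in>S. \<forall>s\<in>S. s \<le> a \<longrightarrow> \<bar>\<gamma> s $ 1 - p $ 1\<bar> < e \<and> \<bar>\<gamma> s $ 2 - p $ 2\<bar> < e"
    and endR: "\<exists>b\<in>S. \<forall>s\<in>S. b \<le> s \<longrightarrow> \<bar>\<gamma> s $ 1 - p $ 1\<bar> < e \<and> \<bar>\<gamma> s $ 2 - p $ 2\<bar> < e"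
    if e: "e > 0" for e
  proof -
    have near: "\<bar>\<gamma> s $ i - p $ i\<bar> < e" if "dist (\<gamma> s) p < e" for s i
      using component_le_norm_cart[of "\<gamma> s - p" i] that by (simp add: dist_norm)
    obtain b where b: "b > s1" "\<And>s. s1 < s \<Longrightarrow> s < b \<Longrightarrow> dist (\<gamma> s) p < e"
      using tendstoD[OF p1 e] unfolding eventually_at_right_field by blast
    have "s1 < min b s2" using b(1) s12 by simp
    then obtain a where a: "s1 < a" "a < min b s2" using dense by blast
    show "\<exists>a\<in>S. \<forall>s\<in>S. s \<le> a \<longrightarrow> \<bar>\<gamma> s $ 1 - p $ 1\<bar> < e \<and> \<bar>\<gamma> s $ 2 - p $ 2\<bar> < e"
      by (rule bexI[of _ a]) (use a b(2) near in \<open>auto simp: S_def\<close>)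
    obtain c where c: "c < s2" "\<And>s. c < s \<Longrightarrow> s < s2 \<Longrightarrow> dist (\<gamma> s) p < e"
      using tendstoD[OF p2 e] unfolding eventually_at_left_field by blast
    have "max c s1 < s2" using c(1) s12 by simp
    then obtain a where a: "max c s1 < a" "a < s2" using dense by blast
    show "\<exists>b\<in>S. \<forall>s\<in>S. b \<le> s \<longrightarrow> \<bar>\<gamma> s $ 1 - p $ 1\<bar> < e \<and> \<bar>\<gamma> s $ 2 - p $ 2\<bar> < e"
      by (rule bexI[of _ a]) (use a c(2) near in \<open>auto simp: S_def\<close>)
  qed
  define X where "X x = \<gamma> (\<sigma> x) $ 1" for x
  define Y where "Y x = \<gamma> (\<sigma> x) $ 2" for x
  have d\<gamma>\<sigma>: "((\<lambda>x. \<gamma> (\<sigma> x)) has_vector_derivative \<rho> x *\<^sub>R dir x) (at x)" if x: "x \<in> I" for x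
  proof -
    have "(\<sigma> has_vector_derivative inverse (\<omega> (\<sigma> x))) (at x)"
      using d\<sigma>[OF x] by (simp add: has_real_derivative_iff_has_vector_derivative)
    from vector_diff_chain_at[OF this d\<gamma>[OF \<sigma>S[OF x]]] show ?thesis
      by (simp add: o_def \<theta>\<sigma>[OF x] \<rho>_def field_simps)
  qed
  have dX: "(X has_real_derivative \<rho> x * cos x) (at x)" if "x \<in> I" for x
    using has_vector_derivative_vec_nth[OF d\<gamma>\<sigma>[OF that], of 1]
    by (simp add: X_def[abs_def] has_real_derivative_iff_has_vector_derivative)
  have dY: "(Y has_real_derivative \<rho> x * sin x) (at x)" if "x \<in> I" for x
    using has_vector_derivative_vec_nth[OF d\<gamma>\<sigma>[OF that], of 2]
    by (simp add: Y_def[abs_def] has_real_derivative_iff_has_vector_derivative)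
  have \<rho>pos: "0 < \<rho> x" if "x \<in> I" for x
    using r\<omega>[OF \<sigma>S[OF that]] by (simp add: \<rho>_def)
  have \<sigma>D: "\<sigma> x \<in> D" and G\<sigma>: "G (\<sigma> x) = (1/2) * \<omega> (\<sigma> x) * (\<rho> x - \<rho> (x + pi))"
    if "x \<in> I" "x + pi \<in> I" for x
    using that \<sigma>S \<theta>\<sigma> by (simp_all add: D_def G_def)
  \<comment> \<open>An interval of angles has an open preimage under \<theta>, which contains an
    interval of parameters; there \<open>nonzero\<close> provides different radii.\<close>
  have strict: "\<exists>x\<in>{a<..<b}. \<rho> (x + pi) \<noteq> \<rho> x"
    if ab: "a < b" and sub: "\<forall>x\<in>{a<..<b}. x \<in> I \<and> x + pi \<in> I" for a b
  proof (rule ccontr)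
    assume neg: "\<not> ?thesis"
    have "open (S \<inter> \<theta> -` {a<..<b})"
      by (rule continuous_open_preimage[OF cont\<theta> openS]) simp
    moreover have "\<sigma> ((a + b) / 2) \<in> S \<inter> \<theta> -` {a<..<b}"
      using ab sub \<sigma>S \<theta>\<sigma> by simp
    ultimately obtain e where e: "e > 0" "ball (\<sigma> ((a + b) / 2)) e \<subseteq> S \<inter> \<theta> -` {a<..<b}"
      by (meson open_contains_ball)
    define c where "c = \<sigma> ((a + b) / 2) - e"
    define d where "d = \<sigma> ((a + b) / 2) + e"
    have cd: "c < d" "{c<..<d} \<subseteq> S \<inter> \<theta> -` {a<..<b}"
      using e by (simp_all add: c_def d_def ball_eq_greaterThanLessThan)
    have "{c<..<d} \<subseteq> D" using cd(2) sub by (auto simp: D_def)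
    then obtain s where "s \<in> {c<..<d}" "G s \<noteq> 0" using nonzero[OF cd(1)] by blast
    then show False using cd(2) neg by (force simp: G_def)
  qed
  have left: "\<exists>a\<in>I. \<forall>x\<in>I. x \<le> a \<longrightarrow> \<bar>X x - p $ 1\<bar> < e \<and> \<bar>Y x - p $ 2\<bar> < e"
    and right: "\<exists>b\<in>I. \<forall>x\<in>I. b \<le> x \<longrightarrow> \<bar>X x - p $ 1\<bar> < e \<and> \<bar>Y x - p $ 2\<bar> < e"
    if e: "e > 0" for e
  proof -
    obtain a where a: "a \<in> S" "\<forall>s\<in>S. s \<le> a \<longrightarrow> \<bar>\<gamma> s $ 1 - p $ 1\<bar> < e \<and> \<bar>\<gamma> s $ 2 - p $ 2\<bar> < e"
      using endL[OF e] by blast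
    obtain b where b: "b \<in> S" "\<forall>s\<in>S. b \<le> s \<longrightarrow> \<bar>\<gamma> s $ 1 - p $ 1\<bar> < e \<and> \<bar>\<gamma> s $ 2 - p $ 2\<bar> < e"
      using endR[OF e] by blast
    \<comment> \<open>For negative curvature the tangent angle reverses the orientation, so the
      lower end of \<open>I\<close> corresponds to the upper end of \<open>S\<close>. As the curve
      has the same limit at both ends, \<open>left\<close> and \<open>right\<close> hold in either
      case.\<close>
    have cmp: "(\<forall>x\<in>I. \<forall>s\<in>S. (x \<le> \<theta> s \<longrightarrow> \<sigma> x \<le> s) \<and> (\<theta> s \<le> x \<longrightarrow> s \<le> \<sigma> x)) \<or>
        (\<forall>x\<in>I. \<forall>s\<in>S. (x \<le> \<theta> s \<longrightarrow> s \<le> \<sigma> x) \<and> (\<theta> s \<le> x \<longrightarrow> \<sigma> x \<le> s))"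
      using mono
    proof
      assume inc: "\<forall>a\<in>S. \<forall>b\<in>S. a < b \<longrightarrow> \<theta> a < \<theta> b"
      show ?thesis by (rule disjI1) (metis inc \<sigma>S \<theta>\<sigma> not_le)
    next
      assume dec: "\<forall>a\<in>S. \<forall>b\<in>S. a < b \<longrightarrow> \<theta> b < \<theta> a"
      show ?thesis by (rule disjI2) (metis dec \<sigma>S \<theta>\<sigma> not_le)
    qed
    then show "\<exists>a\<in>I. \<forall>x\<in>I. x \<le> a \<longrightarrow> \<bar>X x - p $ 1\<bar> < e \<and> \<bar>Y x - p $ 2\<bar> < e"
      unfolding X_def Y_def using a b \<theta>I \<sigma>S by metis
    from cmp show "\<exists>b\<in>I. \<forall>x\<in>I. b \<le> x \<longrightarrow> \<bar>X x - p $ 1\<bar> < e \<and> \<bar>Y x - p $ 2\<bar> < e"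
      unfolding X_def Y_def using a b \<theta>I \<sigma>S by metis
  qed

  \<comment> \<open>Sign change of the derivative along the branch\<close>
  obtain x where x: "x \<in> I" "x + pi \<in> I" "\<rho> x < \<rho> (x + pi)"
    using closed_curve_radius_comparison(1)[OF openI connI I0 dX dY \<rho>pos strict left right] by blast
  obtain y where y: "y \<in> I" "y + pi \<in> I" "\<rho> (y + pi) < \<rho> y"
    using closed_curve_radius_comparison(2)[OF openI connI I0 dX dY \<rho>pos strict left right] by blast
  show False
    using sgn
  proof
    assume "\<forall>s\<in>S. \<omega> s > 0"
    then have "\<omega> (\<sigma> x) > 0" "\<omega> (\<sigma> y) > 0" using \<sigma>S x(1) y(1) by blast+
    then have "G (\<sigma> x) < 0" "G (\<sigma> y) > 0"
      unfolding G\<sigma>[OF x(1,2)] G\<sigma>[OF y(1,2)] using x(3) y(3)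
      by (simp_all add: mult_pos_neg)
    then show False using Gsgn \<sigma>D[OF x(1,2)] \<sigma>D[OF y(1,2)] by (meson not_le)
  next
    assume "\<forall>s\<in>S. \<omega> s < 0"
    then have "\<omega> (\<sigma> x) < 0" "\<omega> (\<sigma> y) < 0" using \<sigma>S x(1) y(1) by blast+
    then have "G (\<sigma> x) > 0" "G (\<sigma> y) < 0"
      unfolding G\<sigma>[OF x(1,2)] G\<sigma>[OF y(1,2)] using x(3) y(3)
      by (simp_all add: mult_neg_pos mult_neg_neg)
    then show False using Gsgn \<sigma>D[OF x(1,2)] \<sigma>D[OF y(1,2)] by (meson not_le)
  qed
qed

end
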